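(* Let $n\ge 2$ be an integer such that $p=(2n-1)(2n+1)$ and $q=(4n-1)(4n+3)$ are coprime, squarefree integers. Let $K=\mathbb{Q}(\sqrt p,\sqrt q)$ and $r=pq$. Let $\varepsilon_p,\varepsilon_q,\varepsilon_r>1$ be the fundamental units of $\mathbb{Q}(\sqrt p),\mathbb{Q}(\sqrt q),\mathbb{Q}(\sqrt r)$ respectively. A complete set of indecomposable elements of $\mathcal{O}_K^+$ modulo totally positive units is given by \begin{align*} &1,\qquad \frac{\varepsilon_p^{-1}+\varepsilon_r}{2},\qquad \frac{\varepsilon_p+\varepsilon_r}{2}+t\left(\varepsilon_p-\varepsilon_q^{-1}\right)\qquad(0\le t\le 2n-2),\\ &\left(\varepsilon_q^{-1}-\varepsilon_p\right)+t\left(\varepsilon_p\varepsilon_q-1\right)\qquad(1\le t\le 2n-1), \end{align*} where $t$ runs over integers in the indicated ranges. In particular, $\iota(K)=4n$.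
   Context: For a totally real number field $F$ with ring of integers $\mathcal{O}_F$, $\mathcal{O}_F^+$ denotes the set of elements of $\mathcal{O}_F$ that are positive under every embedding $F\hookrightarrow\mathbb{R}$ (totally positive). An element $\alpha\in\mathcal{O}_F^+$ is indecomposable if it cannot be written as $\alpha=\beta+\gamma$ with $\beta,\gamma\in\mathcal{O}_F^+$. $\iota(F)$ denotes the (finite) number of indecomposable elements of $\mathcal{O}_F^+$ up to multiplication by totally positive units of $\mathcal{O}_F$. A complete set of indecomposable elements modulo totally positive units is a set of representatives, one for each class, of the indecomposable elements of $\mathcal{O}_F^+$ under the equivalence $\alpha\sim\eta\alpha$ with $\eta$ a totally positive unit of $\mathcal{O}_F$. All square roots are taken positive; explicitly, $\varepsilon_p=2n+\sqrt p$, $\varepsilon_q=\frac{4n+1+\sqrt q}{2}$, $\varepsilon_r=(8n^2+2n-2)+\sqrt r$. *)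

theory Defs
  imports Complex_Main "HOL-Computational_Algebra.Computational_Algebra"
begin

text \<open>
  Number fields are represented as subsets of the reals, so that algebraic operations are those of
  the type \<^typ>\<open>real\<close>, and the ring of integers is cut out by \<^const>\<open>algebraic_int\<close>.
\<close>

definition is_subfield :: "real set \<Rightarrow> bool" where
  "is_subfield F \<longleftrightarrow> 0 \<in> F \<and> 1 \<in> F \<and>
     (\<forall>x\<in>F. \<forall>y\<in>F. x + y \<in> F \<and> x - y \<in> F \<and> x * y \<in> F) \<and>
     (\<forall>x\<in>F. inverse x \<in> F)"

text \<open>Subfields of the reals contain the rationals automatically, so this is \<open>\<rat>(S)\<close>.\<close>

definition rat_adjoin :: "real set \<Rightarrow> real set" where
  "rat_adjoin S = is_subfield hull S"

definition ring_of_integers :: "real set \<Rightarrow> real set" where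
  "ring_of_integers F = {x \<in> F. algebraic_int x}"

text \<open>
  Only the values on \<open>F\<close> matter; \<open>\<sigma> 1 = 1\<close> makes these maps injective on \<open>F\<close>.
\<close>

definition real_embedding :: "real set \<Rightarrow> (real \<Rightarrow> real) \<Rightarrow> bool" where
  "real_embedding F \<sigma> \<longleftrightarrow> \<sigma> 1 = 1 \<and>
     (\<forall>x\<in>F. \<forall>y\<in>F. \<sigma> (x + y) = \<sigma> x + \<sigma> y \<and> \<sigma> (x * y) = \<sigma> x * \<sigma> y)"

text \<open>\<open>\<O>\<^sub>F\<^sup>+\<close>, for a totally real number field \<open>F\<close>.\<close>

definition tot_pos_integers :: "real set \<Rightarrow> real set" where
  "tot_pos_integers F =
     {x \<in> ring_of_integers F. \<forall>\<sigma>. real_embedding F \<sigma> \<longrightarrow> \<sigma> x > 0}"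

definition integer_units :: "real set \<Rightarrow> real set" where
  "integer_units F = {u \<in> ring_of_integers F. \<exists>v\<in>ring_of_integers F. u * v = 1}"

definition tot_pos_units :: "real set \<Rightarrow> real set" where
  "tot_pos_units F = integer_units F \<inter> tot_pos_integers F"

text \<open>Meant for real quadratic fields \<open>F\<close>, whose unit group has rank one.\<close>

definition is_fundamental_unit :: "real set \<Rightarrow> real \<Rightarrow> bool" where
  "is_fundamental_unit F \<epsilon> \<longleftrightarrow> \<epsilon> > 1 \<and> \<epsilon> \<in> integer_units F \<and>
     (\<forall>u\<in>integer_units F. \<exists>k::int. u = \<epsilon> powi k \<or> u = - (\<epsilon> powi k))"

definition indecomposables :: "real set \<Rightarrow> real set" where
  "indecomposables F = {\<alpha> \<in> tot_pos_integers F.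
     \<not> (\<exists>\<beta>\<in>tot_pos_integers F. \<exists>\<gamma>\<in>tot_pos_integers F. \<alpha> = \<beta> + \<gamma>)}"

definition indec_rel :: "real set \<Rightarrow> (real \<times> real) set" where
  "indec_rel F = {(\<alpha>, \<beta>). \<alpha> \<in> indecomposables F \<and> \<beta> \<in> indecomposables F \<and>
     (\<exists>\<eta>\<in>tot_pos_units F. \<beta> = \<eta> * \<alpha>)}"

text \<open>
  The number of classes; it is finite for totally real number fields. As \<^const>\<open>card\<close> is 0 on
  infinite sets, a positive value of \<open>\<iota>\<close> entails finiteness.
\<close>

definition \<iota> :: "real set \<Rightarrow> nat" where
  "\<iota> F = card (indecomposables F // indec_rel F)"

definition complete_set_of_indecomposables :: "real set \<Rightarrow> real set \<Rightarrow> bool" where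
  "complete_set_of_indecomposables F S \<longleftrightarrow>
     S \<subseteq> indecomposables F \<and> (\<forall>\<alpha>\<in>indecomposables F. \<exists>!s. s \<in> S \<and> (s, \<alpha>) \<in> indec_rel F)"

end

theory Submission
  imports Defs "Jordan_Normal_Form.Char_Poly"
begin

text \<open>
  Put \<open>a = 4 n\<close>, \<open>x = \<epsilon>\<^sub>p\<close> and \<open>y = \<epsilon>\<^sub>q\<close>, so that \<open>x + x\<inverse> = a\<close>, \<open>y + y\<inverse> = a + 1\<close> and \<open>1, x, y, x y\<close> is an
  integral basis. The key element is \<open>w = x y - 1\<close>: it satisfies \<open>w\<^sup>2 = x y \<epsilon>\<^sub>r\<close>, so it is a unit, and
  its sign at an embedding depends only on the image of \<open>y\<close>. Hence \<open>w (P - Q y\<inverse>)\<close> with \<open>P\<close>, \<open>Q\<close> in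
  \<open>\<int>[x]\<close> is totally positive iff \<open>Q y\<inverse> < P < Q y\<close> at both embeddings of \<open>\<int>[x]\<close>. Modulo the group
  generated by \<open>x\<close>, \<open>y\<close>, \<open>\<epsilon>\<^sub>r\<close>, the indecomposables are 1 and \<open>c\<^sub>t = w (t - y\<inverse>)\<close> for \<open>1 \<le> t \<le> a\<close>, where
  \<open>c\<^sub>a = y c\<^sub>1\<close>.

  The convex hull of the totally positive integers has two orbits of facets: the unimodular simplex
  with vertices \<open>1, x, y, x y\<close>, and a large facet consisting of two hexagons, on which the sum of the
  coefficients of \<open>Q\<close> is 1. Both facets lie on a hyperplane \<open>l = 1\<close> of an integral functional \<open>l\<close> that
  is positive on totally positive elements; this makes their lattice points indecomposable.
  Conversely, given a totally positive integer, move it by units until neither functional can be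
  decreased. Comparing with the values of the neighbouring facets shows that it lies in the cone over
  one of the two facets, where it is a sum of lattice points of that facet.

  If \<open>c\<^sub>t\<close> and \<open>c\<^sub>s\<close> differ by a unit then, by taking relative norms to \<open>\<rat>(y)\<close>, \<open>t - y\<inverse>\<close> and \<open>s - y\<inverse>\<close>
  differ by a power of \<open>y\<close>, which forces \<open>s = t\<close> in the range \<open>1 \<le> s, t < a\<close>.
\<close>

section \<open>Sums and products of algebraic integers\<close>

text \<open>\<open>v\<close> is an eigenvector of the integer matrix \<open>M\<close> with
  eigenvalue \<open>x\<close>, so \<open>x\<close> is a root of a characteristic polynomial that is
  monic and integral.\<close>

lemma algebraic_int_if_finite_span:
  fixes x :: real and v :: "'i \<Rightarrow> real" and M :: "'i \<Rightarrow> 'i \<Rightarrow> int"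
  assumes fin: "finite I" and nz: "\<exists>i\<in>I. v i \<noteq> 0"
    and M: "\<And>i. i \<in> I \<Longrightarrow> x * v i = (\<Sum>j\<in>I. of_int (M i j) * v j)"
  shows "algebraic_int x"
proof -
  define n where "n = card I"
  obtain h where h: "bij_betw h {0..<n} I"
    using ex_bij_betw_nat_finite[OF fin] n_def by blast
  define A :: "int mat" where "A = mat n n (\<lambda>(i, j). M (h i) (h j))"
  define w where "w = vec n (v \<circ> h)"
  have A: "A \<in> carrier_mat n n" by (simp add: A_def)
  have hI: "i < n \<Longrightarrow> h i \<in> I" for i using h by (auto simp: bij_betw_def)
  obtain i where i: "i < n" "v (h i) \<noteq> 0"
    using nz h unfolding bij_betw_def by force
  have "w \<noteq> 0\<^sub>v n"
  proof
    assume "w = 0\<^sub>v n"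
    hence "w $ i = 0\<^sub>v n $ i" by simp
    thus False using i by (simp add: w_def)
  qed
  moreover have "map_mat real_of_int A *\<^sub>v w = x \<cdot>\<^sub>v w"
  proof (rule eq_vecI)
    fix k assume "k < dim_vec (x \<cdot>\<^sub>v w)"
    hence k: "k < n" by (simp add: w_def)
    have "(map_mat real_of_int A *\<^sub>v w) $ k = (\<Sum>j = 0..<n. of_int (M (h k) (h j)) * v (h j))"
      using k by (simp add: A_def w_def scalar_prod_def)
    also have "\<dots> = (\<Sum>j\<in>I. of_int (M (h k) j) * v j)"
      by (rule sum.reindex_bij_betw[OF h])
    also have "\<dots> = (x \<cdot>\<^sub>v w) $ k"
      using M[OF hI[OF k]] k by (simp add: w_def)
    finally show "(map_mat real_of_int A *\<^sub>v w) $ k = (x \<cdot>\<^sub>v w) $ k" .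
  qed (simp add: A_def w_def)
  ultimately have "eigenvalue (map_mat real_of_int A) x"
    unfolding eigenvalue_def eigenvector_def using A by (intro exI[of _ w]) (simp add: w_def)
  hence "poly (char_poly (map_mat real_of_int A)) x = 0"
    using eigenvalue_root_char_poly[of "map_mat real_of_int A" n x] A by simp
  hence "poly (map_poly of_int (char_poly A)) x = 0"
    using of_int_hom.char_poly_hom[OF A, where 'a = real] by simp
  moreover have "lead_coeff (char_poly A) = 1"
    using degree_monic_char_poly[OF A] by simp
  ultimately show ?thesis unfolding algebraic_int_altdef_ipoly by blast
qed

text \<open>\<open>M\<close> is a companion matrix: multiplication by \<open>x\<close> shifts the
  powers, and only the top power is rewritten by a monic integer polynomial with root
  \<open>x\<close>.\<close>

lemma algebraic_int_powers_span:
  fixes x :: real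
  assumes "algebraic_int x"
  obtains n :: nat and M :: "nat \<Rightarrow> nat \<Rightarrow> int"
  where "n > 0" "\<And>i. i < n \<Longrightarrow> x * x ^ i = (\<Sum>j<n. of_int (M i j) * x ^ j)"
proof -
  obtain p where p: "poly (map_poly of_int p) x = 0" "lead_coeff p = 1"
    using assms unfolding algebraic_int_altdef_ipoly by blast
  define n where "n = degree p"
  have n0: "n > 0"
  proof (rule ccontr)
    assume "\<not> n > 0"
    hence "p = 1" using p(2) unfolding n_def by (metis gr0I monic_degree_0)
    thus False using p(1) by simp
  qed
  have "0 = (\<Sum>j\<le>n. of_int (coeff p j) * x ^ j)"
    using p(1) by (simp add: poly_altdef degree_map_poly coeff_map_poly n_def)
  also have "\<dots> = (\<Sum>j<n. of_int (coeff p j) * x ^ j) + x ^ n"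
    using p(2) by (simp add: lessThan_Suc_atMost[symmetric] n_def)
  finally have top: "x ^ n = (\<Sum>j<n. of_int (- coeff p j) * x ^ j)"
    by (simp add: sum_negf)
  define M where "M i j = (if Suc i < n then (if j = Suc i then 1 else 0) else - coeff p j)" for i j
  have "x * x ^ i = (\<Sum>j<n. of_int (M i j) * x ^ j)" if "i < n" for i
  proof (cases "Suc i < n")
    case True
    hence "(\<Sum>j<n. of_int (M i j) * x ^ j) = (\<Sum>j<n. if j = Suc i then x ^ j else 0)"
      by (intro sum.cong) (auto simp: M_def)
    thus ?thesis using True by simp
  next
    case False
    hence "Suc i = n" using that by simp
    thus ?thesis using top by (simp add: M_def flip: power_Suc)
  qed
  thus ?thesis using that n0 by blast
qed

text \<open>The products \<open>x ^ i * y ^ j\<close> span a finitely generated module stable under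
  multiplication by \<open>x\<close> and by \<open>y\<close>, so the same vector \<open>v\<close>
  serves for sum and product.\<close>

lemma
  fixes x y :: real
  assumes "algebraic_int x" "algebraic_int y"
  shows algebraic_int_add: "algebraic_int (x + y)"
    and algebraic_int_mult: "algebraic_int (x * y)"
proof -
  obtain m M where m: "m > 0" and M: "\<And>i. i < m \<Longrightarrow> x * x ^ i = (\<Sum>j<m. of_int (M i j) * x ^ j)"
    using algebraic_int_powers_span[OF assms(1)] by blast
  obtain n N where n: "n > 0" and N: "\<And>i. i < n \<Longrightarrow> y * y ^ i = (\<Sum>j<n. of_int (N i j) * y ^ j)"
    using algebraic_int_powers_span[OF assms(2)] by blast
  define I where "I = {..<m} \<times> {..<n}"
  define v where "v = (\<lambda>(i, j). x ^ i * y ^ j)"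
  have fin: "finite I" by (simp add: I_def)
  have nz: "\<exists>i\<in>I. v i \<noteq> 0"
    by (rule bexI[of _ "(0, 0)"]) (use m n in \<open>auto simp: I_def v_def\<close>)
  have X: "x * v k = (\<Sum>l\<in>I. of_int (if snd l = snd k then M (fst k) (fst l) else 0) * v l)"
    if "k \<in> I" for k
  proof -
    obtain i j where k: "k = (i, j)" "i < m" "j < n" using \<open>k \<in> I\<close> by (auto simp: I_def)
    have "x * v k = (\<Sum>i'<m. of_int (M i i') * x ^ i') * y ^ j"
      using M[OF k(2)] by (simp add: k v_def)
    also have "\<dots> = (\<Sum>i'<m. \<Sum>j'<n. if j' = j then of_int (M i i') * (x ^ i' * y ^ j') else 0)"
      using k(3) by (simp add: sum_distrib_right mult.assoc)
    also have "\<dots> = (\<Sum>l\<in>I. of_int (if snd l = snd k then M (fst k) (fst l) else 0) * v l)"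
      unfolding I_def sum.cartesian_product by (intro sum.cong) (auto simp: k v_def)
    finally show ?thesis .
  qed
  have Y: "y * v k = (\<Sum>l\<in>I. of_int (if fst l = fst k then N (snd k) (snd l) else 0) * v l)"
    if "k \<in> I" for k
  proof -
    obtain i j where k: "k = (i, j)" "i < m" "j < n" using \<open>k \<in> I\<close> by (auto simp: I_def)
    have "y * v k = x ^ i * (\<Sum>j'<n. of_int (N j j') * y ^ j')"
      using N[OF k(3)] by (simp add: k v_def mult.left_commute)
    also have "\<dots> = (\<Sum>j'<n. of_int (N j j') * (x ^ i * y ^ j'))"
      by (simp add: sum_distrib_left mult_ac)
    also have "\<dots> = (\<Sum>i'<m. if i' = i then \<Sum>j'<n. of_int (N j j') * (x ^ i' * y ^ j') else 0)"
      using k(2) by simp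
    also have "\<dots> = (\<Sum>i'<m. \<Sum>j'<n. if i' = i then of_int (N j j') * (x ^ i' * y ^ j') else 0)"
      by (intro sum.cong) auto
    also have "\<dots> = (\<Sum>l\<in>I. of_int (if fst l = fst k then N (snd k) (snd l) else 0) * v l)"
      unfolding I_def sum.cartesian_product by (intro sum.cong) (auto simp: k v_def)
    finally show ?thesis .
  qed
  show "algebraic_int (x + y)"
    by (rule algebraic_int_if_finite_span[OF fin nz, where M = "\<lambda>k l.
          (if snd l = snd k then M (fst k) (fst l) else 0) + (if fst l = fst k then N (snd k) (snd l) else 0)"])
       (simp only: distrib_right of_int_add sum.distrib X Y)
  show "algebraic_int (x * y)"
  proof (rule algebraic_int_if_finite_span[OF fin nz, where M = "\<lambda>k l. M (fst k) (fst l) * N (snd k) (snd l)"])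
    fix k assume "k \<in> I"
    then obtain i j where k: "k = (i, j)" "i < m" "j < n" by (auto simp: I_def)
    have "x * y * v k = (x * x ^ i) * (y * y ^ j)" by (simp add: k v_def)
    also have "\<dots> = (\<Sum>l\<in>I. of_int (M i (fst l)) * x ^ fst l * (of_int (N j (snd l)) * y ^ snd l))"
      unfolding M[OF k(2)] N[OF k(3)] sum_product I_def sum.cartesian_product
      by (intro sum.cong) auto
    also have "\<dots> = (\<Sum>l\<in>I. of_int (M (fst k) (fst l) * N (snd k) (snd l)) * v l)"
      by (intro sum.cong) (auto simp: k v_def)
    finally show "x * y * v k = (\<Sum>l\<in>I. of_int (M (fst k) (fst l) * N (snd k) (snd l)) * v l)" .
  qed
qed

lemma algebraic_int_diff:
  fixes x y :: real
  assumes "algebraic_int x" "algebraic_int y"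
  shows "algebraic_int (x - y)"
  using algebraic_int_add[OF assms(1) algebraic_int_minus[OF assms(2)]] by simp

section \<open>Subfields of the reals and their embeddings\<close>

lemma is_subfieldD:
  assumes "is_subfield F"
  shows "0 \<in> F" "1 \<in> F"
    and "\<And>x y. x \<in> F \<Longrightarrow> y \<in> F \<Longrightarrow> x + y \<in> F"
    and "\<And>x y. x \<in> F \<Longrightarrow> y \<in> F \<Longrightarrow> x - y \<in> F"
    and "\<And>x y. x \<in> F \<Longrightarrow> y \<in> F \<Longrightarrow> x * y \<in> F"
    and "\<And>x. x \<in> F \<Longrightarrow> inverse x \<in> F"
    and "\<And>x. x \<in> F \<Longrightarrow> - x \<in> F"
    and "\<And>x y. x \<in> F \<Longrightarrow> y \<in> F \<Longrightarrow> x / y \<in> F"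
proof -
  show "- x \<in> F" if "x \<in> F" for x
    using assms that unfolding is_subfield_def by (metis diff_0)
  show "x / y \<in> F" if "x \<in> F" "y \<in> F" for x y
    using assms that unfolding is_subfield_def divide_inverse by blast
qed (use assms in \<open>auto simp: is_subfield_def\<close>)

lemma is_subfield_power: "is_subfield F \<Longrightarrow> x \<in> F \<Longrightarrow> x ^ (k::nat) \<in> F"
  by (induction k) (simp_all add: is_subfieldD)

lemma is_subfield_sum:
  "is_subfield F \<Longrightarrow> (\<And>i. i \<in> I \<Longrightarrow> f i \<in> F) \<Longrightarrow> sum f I \<in> F"
  by (induction I rule: infinite_finite_induct) (simp_all add: is_subfieldD)

lemma is_subfield_of_int:
  assumes "is_subfield F" shows "of_int k \<in> F"
proof -
  have nat: "of_nat m \<in> F" for m :: nat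
    by (induction m) (simp_all add: is_subfieldD[OF assms])
  show ?thesis
    using nat[of "nat k"] is_subfieldD(7)[OF assms nat[of "nat (- k)"]]
    by (cases "k \<ge> 0") auto
qed

lemma is_subfield_Rats: "is_subfield \<rat>"
  by (auto simp: is_subfield_def)

lemma Rats_subset_subfield:
  assumes "is_subfield F" shows "\<rat> \<subseteq> F"
proof
  fix x :: real assume "x \<in> \<rat>"
  then obtain a b :: int where "x = of_int a / of_int b"
    by (auto elim: Rats_cases')
  thus "x \<in> F" using assms by (simp add: is_subfieldD(8) is_subfield_of_int)
qed

definition quad_ext :: "real set \<Rightarrow> real \<Rightarrow> real set" where
  "quad_ext F s = {b + c * s | b c. b \<in> F \<and> c \<in> F}"

lemma quad_extI: "b \<in> F \<Longrightarrow> c \<in> F \<Longrightarrow> b + c * s \<in> quad_ext F s"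
  by (auto simp: quad_ext_def)

lemma quad_extE:
  assumes "z \<in> quad_ext F s"
  obtains b c where "b \<in> F" "c \<in> F" "z = b + c * s"
  using assms by (auto simp: quad_ext_def)

lemma subset_quad_ext:
  assumes "is_subfield F" shows "F \<subseteq> quad_ext F s" "s \<in> quad_ext F s"
proof -
  show "F \<subseteq> quad_ext F s"
    using quad_extI[of _ F 0 s] is_subfieldD(1)[OF assms] by auto
  show "s \<in> quad_ext F s"
    using quad_extI[of 0 F 1 s] is_subfieldD(1,2)[OF assms] by auto
qed

lemma is_subfield_quad_ext:
  assumes F: "is_subfield F" and s: "s * s \<in> F"
  shows "is_subfield (quad_ext F s)"
proof -
  note F' = is_subfieldD[OF F]
  have inv: "inverse z \<in> quad_ext F s" if "z \<in> quad_ext F s" for z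
  proof -
    obtain b c where z: "b \<in> F" "c \<in> F" "z = b + c * s"
      using \<open>z \<in> quad_ext F s\<close> by (rule quad_extE)
    show ?thesis
    \<comment> \<open>Inversion multiplies by the conjugate \<open>b - c * s\<close>. Since
      \<open>s\<close> may lie in \<open>F\<close>, this can vanish for nonzero \<open>z\<close>,
      but then \<open>z = 2 * b\<close> is in \<open>F\<close>.\<close>
    proof (cases "b - c * s = 0")
      case True
      hence "z = 2 * b" using z by simp
      moreover have "2 * b \<in> F" using F'(3)[OF z(1) z(1)] by simp
      ultimately show ?thesis using subset_quad_ext[OF F] F'(6)[of z] by auto
    next
      case False
      define d where "d = b * b - c * c * (s * s)"
      have "d \<in> F" unfolding d_def using z s by (simp add: F')
      moreover have dz: "d = z * (b - c * s)" by (simp add: d_def z algebra_simps)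
      have "inverse z = b / d + (- c / d) * s"
      \<comment> \<open>If \<open>z = 0\<close> then \<open>d = 0\<close> as well, and both sides
        are 0 because division by 0 gives 0.\<close>
      proof (cases "z = 0")
        case False
        hence "inverse z = (b - c * s) / d"
          using \<open>b - c * s \<noteq> 0\<close> unfolding dz by (simp add: inverse_eq_divide)
        thus ?thesis by (simp add: diff_divide_distrib)
      qed (simp add: dz)
      ultimately show ?thesis
        using z F' by (metis quad_extI)
    qed
  qed
  have "x + y \<in> quad_ext F s \<and> x - y \<in> quad_ext F s \<and> x * y \<in> quad_ext F s"
    if "x \<in> quad_ext F s" "y \<in> quad_ext F s" for x y
  proof -
    obtain b c where x: "b \<in> F" "c \<in> F" "x = b + c * s"
      using \<open>x \<in> quad_ext F s\<close> by (rule quad_extE)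
    obtain d e where y: "d \<in> F" "e \<in> F" "y = d + e * s"
      using \<open>y \<in> quad_ext F s\<close> by (rule quad_extE)
    have "x + y = (b + d) + (c + e) * s" "x - y = (b - d) + (c - e) * s"
      "x * y = (b * d + c * e * (s * s)) + (b * e + c * d) * s"
      by (auto simp: x y algebra_simps)
    thus ?thesis using x(1,2) y(1,2) s by (simp add: F' quad_extI)
  qed
  thus ?thesis using inv subset_quad_ext[OF F] is_subfieldD(1,2)[OF F]
    unfolding is_subfield_def by blast
qed

lemma quad_ext_least:
  assumes "is_subfield L" "F \<subseteq> L" "s \<in> L"
  shows "quad_ext F s \<subseteq> L"
  using assms by (auto simp: quad_ext_def is_subfieldD subset_iff)

lemma rat_adjoin_one:
  assumes "s * s \<in> \<rat>"
  shows "rat_adjoin {s} = quad_ext \<rat> s"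
  unfolding rat_adjoin_def
proof (rule hull_unique)
  show "{s} \<subseteq> quad_ext \<rat> s" using subset_quad_ext[OF is_subfield_Rats] by blast
  show "is_subfield (quad_ext \<rat> s)" by (rule is_subfield_quad_ext[OF is_subfield_Rats assms])
  fix L assume "{s} \<subseteq> L" "is_subfield L"
  thus "quad_ext \<rat> s \<subseteq> L"
    using Rats_subset_subfield by (intro quad_ext_least) auto
qed

lemma rat_adjoin_two:
  assumes s: "s * s \<in> \<rat>" and t: "t * t \<in> \<rat>"
  shows "rat_adjoin {s, t} = quad_ext (quad_ext \<rat> s) t"
  unfolding rat_adjoin_def
proof (rule hull_unique)
  let ?F = "quad_ext \<rat> s"
  have F: "is_subfield ?F" by (rule is_subfield_quad_ext[OF is_subfield_Rats s])
  show "{s, t} \<subseteq> quad_ext ?F t"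
    using subset_quad_ext[OF is_subfield_Rats, of s] subset_quad_ext[OF F, of t] by blast
  show "is_subfield (quad_ext ?F t)"
    using is_subfield_quad_ext[OF F] t subset_quad_ext[OF is_subfield_Rats, of s] by blast
  fix L assume L: "{s, t} \<subseteq> L" "is_subfield L"
  show "quad_ext ?F t \<subseteq> L"
    using L Rats_subset_subfield[OF L(2)] by (intro quad_ext_least) auto
qed

section \<open>Real embeddings and their extension to quadratic extensions\<close>

lemma real_embeddingD:
  assumes \<sigma>: "real_embedding F \<sigma>" and F: "is_subfield F"
  shows "\<sigma> 0 = 0" "\<sigma> 1 = 1"
    and "\<And>x y. x \<in> F \<Longrightarrow> y \<in> F \<Longrightarrow> \<sigma> (x + y) = \<sigma> x + \<sigma> y"
    and "\<And>x y. x \<in> F \<Longrightarrow> y \<in> F \<Longrightarrow> \<sigma> (x * y) = \<sigma> x * \<sigma> y"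
    and "\<And>x. x \<in> F \<Longrightarrow> \<sigma> (- x) = - \<sigma> x"
    and "\<And>x y. x \<in> F \<Longrightarrow> y \<in> F \<Longrightarrow> \<sigma> (x - y) = \<sigma> x - \<sigma> y"
    and "\<And>k. \<sigma> (of_int k) = of_int k"
proof -
  note F' = is_subfieldD[OF F]
  show add: "\<sigma> (x + y) = \<sigma> x + \<sigma> y" and "\<sigma> (x * y) = \<sigma> x * \<sigma> y"
    if "x \<in> F" "y \<in> F" for x y using \<sigma> that by (auto simp: real_embedding_def)
  show one: "\<sigma> 1 = 1" using \<sigma> by (simp add: real_embedding_def)
  show zero: "\<sigma> 0 = 0" using add[of 0 0] F' by simp
  show neg: "\<sigma> (- x) = - \<sigma> x" if "x \<in> F" for x
    using add[of x "- x"] that F' zero by simp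
  show "\<sigma> (x - y) = \<sigma> x - \<sigma> y" if "x \<in> F" "y \<in> F" for x y
    using add[of x "- y"] neg[of y] that F' by simp
  have nat: "\<sigma> (of_nat m) = of_nat m" for m :: nat
  proof (induction m)
    case (Suc m)
    have "of_nat m \<in> F" using is_subfield_of_int[OF F, of "int m"] by simp
    thus ?case using add[of 1 "of_nat m"] Suc F' one by simp
  qed (use zero in simp)
  show "\<sigma> (of_int k) = of_int k" for k
  proof (cases "k \<ge> 0")
    case True
    thus ?thesis using nat[of "nat k"] by simp
  next
    case False
    have "real m \<in> F" for m using is_subfield_of_int[OF F, of "int m"] by simp
    hence "\<sigma> (- real (nat (- k))) = - real (nat (- k))"
      using nat neg by simp
    thus ?thesis using False by simp
  qed
qed

lemma real_embedding_power:
  assumes "real_embedding F \<sigma>" "is_subfield F" "x \<in> F"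
  shows "\<sigma> (x ^ k) = \<sigma> x ^ (k::nat)"
  by (induction k) (simp_all add: real_embeddingD[OF assms(1,2)] is_subfield_power assms)

lemma real_embedding_sum:
  assumes "real_embedding F \<sigma>" "is_subfield F" "\<And>i. i \<in> I \<Longrightarrow> f i \<in> F"
  shows "\<sigma> (sum f I) = (\<Sum>i\<in>I. \<sigma> (f i))"
  using assms(3)
  by (induction I rule: infinite_finite_induct)
     (simp_all add: real_embeddingD[OF assms(1,2)] is_subfield_sum[OF assms(2)])

text \<open>An embedding fixes the integers, hence commutes with integer polynomials and maps roots
  to roots.\<close>

lemma algebraic_int_real_embedding:
  assumes \<sigma>: "real_embedding F \<sigma>" and F: "is_subfield F" and x: "x \<in> F" "algebraic_int x"
  shows "algebraic_int (\<sigma> x)"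
proof -
  obtain p where p: "poly (map_poly of_int p) x = 0" "lead_coeff p = 1"
    using x(2) unfolding algebraic_int_altdef_ipoly by blast
  have poly: "poly (map_poly of_int p) z = (\<Sum>i\<le>degree p. of_int (coeff p i) * z ^ i)" for z :: real
    by (simp add: poly_altdef degree_map_poly coeff_map_poly)
  have "poly (map_poly of_int p) (\<sigma> x) = \<sigma> (poly (map_poly of_int p) x)"
    unfolding poly
    by (subst real_embedding_sum[OF \<sigma> F])
       (simp_all add: real_embeddingD[OF \<sigma> F] real_embedding_power[OF \<sigma> F] x is_subfield_of_int[OF F]
          is_subfield_power[OF F] is_subfieldD(5)[OF F])
  also have "\<dots> = 0" using p(1) real_embeddingD(1)[OF \<sigma> F] by simp
  finally show ?thesis using p(2) unfolding algebraic_int_altdef_ipoly by blast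
qed

lemma real_embedding_id: "real_embedding F (\<lambda>x. x)"
  by (simp add: real_embedding_def)

lemma quad_ext_coords_unique:
  assumes F: "is_subfield F" and s: "s \<notin> F"
    and "b \<in> F" "c \<in> F" "d \<in> F" "e \<in> F" "b + c * s = d + e * s"
  shows "b = d \<and> c = e"
proof -
  have "c = e"
  proof (rule ccontr)
    assume "c \<noteq> e"
    hence "s = (d - b) / (c - e)" using assms(7) by (simp add: field_simps)
    thus False using s assms(3-6) is_subfieldD(4,8)[OF F] by blast
  qed
  thus ?thesis using assms(7) by simp
qed

text \<open>Coordinates with respect to 1 and \<open>s\<close> are unique and multiply by a rule
  that involves only \<open>s * s\<close>, so \<open>s\<close> may be sent to any square root
  \<open>t\<close> of the image of \<open>s * s\<close>.\<close>

lemma real_embedding_quad_ext: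
  assumes F: "is_subfield F" and \<sigma>: "real_embedding F \<sigma>"
    and s: "s \<notin> F" "s * s \<in> F" and t: "t * t = \<sigma> (s * s)"
  obtains \<tau> where "real_embedding (quad_ext F s) \<tau>" "\<And>x. x \<in> F \<Longrightarrow> \<tau> x = \<sigma> x" "\<tau> s = t"
proof -
  define co where "co z = (THE bc. fst bc \<in> F \<and> snd bc \<in> F \<and> z = fst bc + snd bc * s)" for z
  have co: "co (b + c * s) = (b, c)" if "b \<in> F" "c \<in> F" for b c
    unfolding co_def
  proof (rule the_equality)
    fix bc assume "fst bc \<in> F \<and> snd bc \<in> F \<and> b + c * s = fst bc + snd bc * s"
    thus "bc = (b, c)"
      using quad_ext_coords_unique[OF F s(1) that, of "fst bc" "snd bc"] by (simp add: prod_eq_iff)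
  qed (use that in simp)
  define \<tau> where "\<tau> z = \<sigma> (fst (co z)) + \<sigma> (snd (co z)) * t" for z
  have \<tau>: "\<tau> (b + c * s) = \<sigma> b + \<sigma> c * t" if "b \<in> F" "c \<in> F" for b c
    using co[OF that] by (simp add: \<tau>_def)
  note F' = is_subfieldD[OF F] and \<sigma>' = real_embeddingD[OF \<sigma> F]
  have base: "\<tau> x = \<sigma> x" if "x \<in> F" for x
    using \<tau>[of x 0] that F' \<sigma>' by simp
  have "\<tau> (x + y) = \<tau> x + \<tau> y \<and> \<tau> (x * y) = \<tau> x * \<tau> y"
    if "x \<in> quad_ext F s" "y \<in> quad_ext F s" for x y
  proof -
    obtain b c where x: "b \<in> F" "c \<in> F" "x = b + c * s"
      using \<open>x \<in> quad_ext F s\<close> by (rule quad_extE)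
    obtain d e where y: "d \<in> F" "e \<in> F" "y = d + e * s"
      using \<open>y \<in> quad_ext F s\<close> by (rule quad_extE)
    have xy: "x + y = (b + d) + (c + e) * s"
      "x * y = (b * d + c * e * (s * s)) + (b * e + c * d) * s"
      by (auto simp: x y algebra_simps)
    have add: "\<tau> (x + y) = \<tau> x + \<tau> y"
      unfolding xy using x(1,2) y(1,2) F'
      by (subst \<tau>) (simp_all add: \<sigma>' \<tau> x(3) y(3) algebra_simps)
    have "\<tau> (x * y) = \<sigma> (b * d + c * e * (s * s)) + \<sigma> (b * e + c * d) * t"
      unfolding xy using x(1,2) y(1,2) F' s by (subst \<tau>) simp_all
    also have "\<dots> = \<sigma> b * \<sigma> d + \<sigma> c * \<sigma> e * (t * t) + (\<sigma> b * \<sigma> e + \<sigma> c * \<sigma> d) * t"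
      using x(1,2) y(1,2) F' s t by (simp add: \<sigma>')
    also have "\<dots> = \<tau> x * \<tau> y"
      using x(1,2) y(1,2) by (simp add: x(3) y(3) \<tau> algebra_simps)
    finally show ?thesis using add by simp
  qed
  moreover have "\<tau> 1 = 1" using base F' \<sigma>' by simp
  ultimately have "real_embedding (quad_ext F s) \<tau>" by (simp add: real_embedding_def)
  moreover have "\<tau> s = t" using \<tau>[of 0 1] F' \<sigma>' by simp
  ultimately show ?thesis using base that by blast
qed

section \<open>Integers and units of real quadratic fields\<close>

lemma algebraic_int_of_int: "algebraic_int (of_int k :: real)"
  by (rule int_imp_algebraic_int) simp

lemma algebraic_int_quadratic:
  fixes z :: real
  assumes "z * z = of_int s * z - of_int t"
  shows "algebraic_int z"
proof (rule algebraic_int.intros[of "[:of_int t, - of_int s, 1:]"])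
  show "\<forall>i. coeff [:of_int t, - of_int s, 1:] i \<in> (\<int> :: real set)"
    by (auto simp: coeff_pCons split: nat.splits)
  show "poly [:of_int t, - of_int s, 1:] z = 0"
    using assms by (simp add: algebra_simps)
qed simp

text \<open>With \<open>z = s / t\<close> in lowest terms, the square of \<open>t\<close> divides
  \<open>s * s * d\<close> and is coprime to \<open>s * s\<close>, so it divides the squarefree
  \<open>d\<close>.\<close>

lemma squarefree_rat_in_Ints:
  fixes d :: int and z :: real
  assumes d: "squarefree d" and z: "z \<in> \<rat>" and zd: "z * z * of_int d \<in> \<int>"
  shows "z \<in> \<int>"
proof -
  obtain s t where st: "t > 0" "coprime s t" "z = of_int s / of_int t"
    using z by (auto elim: Rats_cases')
  obtain N where N: "z * z * of_int d = of_int N" using zd by (auto elim: Ints_cases)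
  have "of_int (s * s * d) = (of_int (N * (t * t)) :: real)"
    using N st(1) by (simp add: st(3) field_simps)
  hence "s * s * d = N * (t * t)" by (simp only: of_int_eq_iff)
  hence "t\<^sup>2 dvd (s * s) * d" by (simp add: power2_eq_square)
  moreover have "coprime (t\<^sup>2) (s * s)"
    using st(2) by (simp add: coprime_commute)
  ultimately have "t\<^sup>2 dvd d" by (simp add: coprime_dvd_mult_right_iff)
  hence "is_unit t" using d by (simp add: squarefree_def)
  hence "t = 1" using st(1) by simp
  thus ?thesis by (simp add: st(3))
qed

lemma sqrt_squarefree_irrational:
  fixes d :: int
  assumes "squarefree d" "d > 1"
  shows "sqrt (of_int d) \<notin> \<rat>"
proof
  assume "sqrt (of_int d) \<in> \<rat>"
  moreover have "algebraic_int (sqrt (of_int d))"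
    by (intro algebraic_int_sqrt algebraic_int_of_int)
  ultimately obtain k where k: "sqrt (of_int d) = of_int k"
    using rational_algebraic_int_is_int Ints_cases by blast
  have "of_int d = (of_int (k\<^sup>2) :: real)"
    using assms(2) real_sqrt_pow2[of "of_int d"] by (simp add: k)
  hence dk: "d = k\<^sup>2" by (simp only: of_int_eq_iff)
  hence "is_unit k" using assms(1) by (simp add: squarefree_def)
  thus False using dk assms(2) by (auto simp: zdvd1_eq abs_if power2_eq_square split: if_splits)
qed

abbreviation quad_field :: "int \<Rightarrow> real set" where
  "quad_field d \<equiv> quad_ext \<rat> (sqrt (of_int d))"

lemma quad_field:
  assumes "d \<ge> 0"
  shows "is_subfield (quad_field d)" "rat_adjoin {sqrt (of_int d)} = quad_field d"
  using assms by (auto intro!: is_subfield_quad_ext is_subfield_Rats rat_adjoin_one)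

lemma quad_conj:
  assumes "squarefree d" "d > 1"
  shows "\<exists>\<sigma>. real_embedding (quad_field d) \<sigma> \<and>
    (\<forall>b\<in>\<rat>. \<forall>c\<in>\<rat>. \<sigma> (b + c * sqrt (of_int d)) = b - c * sqrt (of_int d))"
proof -
  let ?s = "sqrt (of_int d)"
  obtain \<sigma> where \<sigma>: "real_embedding (quad_field d) \<sigma>" "\<And>x. x \<in> \<rat> \<Longrightarrow> \<sigma> x = x" "\<sigma> ?s = - ?s"
    using real_embedding_quad_ext[OF is_subfield_Rats real_embedding_id, of ?s "- ?s"]
      sqrt_squarefree_irrational[OF assms] assms by auto
  have "\<sigma> (b + c * ?s) = b - c * ?s" if "b \<in> \<rat>" "c \<in> \<rat>" for b c
  proof -
    have F: "is_subfield (quad_field d)" using quad_field assms by simp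
    have sub: "\<rat> \<subseteq> quad_field d" "?s \<in> quad_field d"
      using subset_quad_ext[OF is_subfield_Rats] by auto
    show ?thesis
      using that sub \<sigma> by (simp add: real_embeddingD[OF \<sigma>(1) F] is_subfieldD[OF F] subset_iff)
  qed
  thus ?thesis using \<sigma>(1) by blast
qed

text \<open>Trace and norm are rational algebraic integers, hence integers. Together they make
  \<open>(2 * c) * (2 * c) * d\<close> an integer, and squarefreeness of \<open>d\<close> passes
  this on to \<open>2 * c\<close>.\<close>

lemma quad_int_coeffs:
  assumes d: "squarefree d" "d > 1" and bc: "b \<in> \<rat>" "c \<in> \<rat>"
    and int: "algebraic_int (b + c * sqrt (of_int d))"
  obtains m k :: int where "2 * b = of_int m" "2 * c = of_int k" "4 dvd m\<^sup>2 - d * k\<^sup>2"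
proof -
  let ?s = "sqrt (of_int d)"
  have F: "is_subfield (quad_field d)" using quad_field d by simp
  obtain \<sigma> where \<sigma>: "real_embedding (quad_field d) \<sigma>"
    "\<And>b c. b \<in> \<rat> \<Longrightarrow> c \<in> \<rat> \<Longrightarrow> \<sigma> (b + c * ?s) = b - c * ?s"
    using quad_conj[OF d] by blast
  have conj: "algebraic_int (b - c * ?s)"
    using algebraic_int_real_embedding[OF \<sigma>(1) F quad_extI[OF bc] int] \<sigma>(2)[OF bc] by simp
  have "2 * b \<in> \<int>"
    using algebraic_int_add[OF int conj] bc by (intro rational_algebraic_int_is_int) auto
  moreover have prod: "(b + c * ?s) * (b - c * ?s) = b * b - c * c * of_int d"
    using d by (simp add: algebra_simps)
  have "b * b - c * c * of_int d \<in> \<int>"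
    using algebraic_int_mult[OF int conj] bc unfolding prod
    by (intro rational_algebraic_int_is_int) auto
  ultimately obtain m N where m: "2 * b = of_int m" and N: "b * b - c * c * of_int d = of_int N"
    by (auto elim!: Ints_cases)
  have mN: "(2 * c) * (2 * c) * of_int d = of_int (m\<^sup>2 - 4 * N)"
    using N m[symmetric] by (simp add: power2_eq_square algebra_simps)
  have "2 * c \<in> \<int>"
    using squarefree_rat_in_Ints[OF d(1), of "2 * c"] bc unfolding mN by simp
  then obtain k where k: "2 * c = of_int k" by (auto elim: Ints_cases)
  have "of_int (k\<^sup>2 * d) = (of_int (m\<^sup>2 - 4 * N) :: real)"
    using mN unfolding k by (simp add: power2_eq_square)
  hence "k\<^sup>2 * d = m\<^sup>2 - 4 * N" by (simp only: of_int_eq_iff)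
  hence "m\<^sup>2 - d * k\<^sup>2 = 4 * N" by (simp add: mult.commute)
  thus ?thesis using that m k by simp
qed

text \<open>Modulo 4 the difference is a sum of two squares, and squares are 0 or 1 modulo
  4.\<close>

lemma dvd4_3_mod_4:
  fixes m k d :: int
  assumes "d mod 4 = 3" "4 dvd m\<^sup>2 - d * k\<^sup>2"
  shows "even m" "even k"
proof -
  have "(m\<^sup>2 + k\<^sup>2) mod 4 = 0"
  proof -
    obtain t where t: "d = 4 * t + 3" using assms(1) mult_div_mod_eq[of 4 d] by metis
    have "m\<^sup>2 + k\<^sup>2 = (m\<^sup>2 - d * k\<^sup>2) + 4 * ((t + 1) * k\<^sup>2)" by (simp add: t algebra_simps)
    hence "4 dvd m\<^sup>2 + k\<^sup>2" using assms(2) by (simp only: dvd_add dvd_triv_left)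
    thus ?thesis by simp
  qed
  moreover have sq: "z\<^sup>2 mod 4 = (if even z then 0 else 1)" for z :: int
  proof (cases "even z")
    case True
    then obtain w where "z = 2 * w" by blast
    thus ?thesis by (simp add: power2_eq_square)
  next
    case False
    then obtain w where "z = 2 * w + 1" by (elim oddE)
    hence "z\<^sup>2 = 4 * (w * w + w) + 1" by (simp add: power2_eq_square algebra_simps)
    hence "z\<^sup>2 mod 4 = 1" by presburger
    thus ?thesis using False by simp
  qed
  ultimately have "((if even m then 0 else 1) + (if even k then 0 else 1)) mod (4 :: int) = 0"
    using mod_add_eq[of "m\<^sup>2" 4 "k\<^sup>2"] by simp
  thus "even m" "even k" by (auto split: if_splits)
qed

lemma quad_int_3_mod_4:
  assumes "squarefree d" "d > 1" "d mod 4 = 3" "b \<in> \<rat>" "c \<in> \<rat>"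
    and "algebraic_int (b + c * sqrt (of_int d))"
  shows "b \<in> \<int>" "c \<in> \<int>"
proof -
  obtain m k where mk: "2 * b = of_int m" "2 * c = of_int k" "4 dvd m\<^sup>2 - d * k\<^sup>2"
    using quad_int_coeffs[OF assms(1,2,4,5,6)] .
  obtain m' k' where "m = 2 * m'" "k = 2 * k'"
    using dvd4_3_mod_4[OF assms(3) mk(3)] by blast
  hence "b = of_int m'" "c = of_int k'" using mk by simp_all
  thus "b \<in> \<int>" "c \<in> \<int>" by simp_all
qed

text \<open>An even \<open>m\<close> forces \<open>d * k^2\<close> to be even. In the biquadratic
  field, the integrality of the rational part is supplied by another quadratic subfield.\<close>

lemma quad_int_1_mod_4:
  assumes "squarefree d" "d > 1" "odd d" "b \<in> \<int>" "c \<in> \<rat>"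
    and "algebraic_int (b + c * sqrt (of_int d))"
  shows "c \<in> \<int>"
proof -
  have "b \<in> \<rat>" using assms(4) Ints_subset_Rats by blast
  then obtain m k where mk: "2 * b = of_int m" "2 * c = of_int k" "4 dvd m\<^sup>2 - d * k\<^sup>2"
    using quad_int_coeffs[OF assms(1,2) _ assms(5,6)] by blast
  obtain b' where "b = of_int b'" using assms(4) by (auto elim: Ints_cases)
  hence "of_int m = (of_int (2 * b') :: real)" using mk by simp
  hence "m = 2 * b'" by (simp only: of_int_eq_iff)
  moreover have "even (m\<^sup>2 - d * k\<^sup>2)" using mk(3) by (meson dvd_trans even_numeral)
  ultimately have "even k" using assms(3) by simp
  then obtain k' where "k = 2 * k'" by blast
  hence "c = of_int k'" using mk by simp
  thus ?thesis by simp
qed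

text \<open>The norm of a unit is 1 or -1, so \<open>u > 1\<close> has a conjugate of absolute value
  below 1. Comparing \<open>b + c * sqrt d\<close> with \<open>b - c * sqrt d\<close> makes both
  parts positive.\<close>

lemma integer_unit_gt_1:
  assumes d: "squarefree d" "d > 1" and u: "u \<in> integer_units (quad_field d)" "u > 1"
  obtains m k :: int where "u = (of_int m + of_int k * sqrt (of_int d)) / 2" "m \<ge> 1" "k \<ge> 1"
    "4 dvd m\<^sup>2 - d * k\<^sup>2"
proof -
  let ?s = "sqrt (of_int d)"
  have F: "is_subfield (quad_field d)" using quad_field d by simp
  obtain \<sigma> where \<sigma>: "real_embedding (quad_field d) \<sigma>"
    "\<And>b c. b \<in> \<rat> \<Longrightarrow> c \<in> \<rat> \<Longrightarrow> \<sigma> (b + c * ?s) = b - c * ?s"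
    using quad_conj[OF d] by blast
  have norm_Ints: "z * \<sigma> z \<in> \<int>" if z: "z \<in> ring_of_integers (quad_field d)" for z
  proof -
    have zF: "z \<in> quad_field d" "algebraic_int z" using z by (auto simp: ring_of_integers_def)
    obtain b c where bc: "b \<in> \<rat>" "c \<in> \<rat>" "z = b + c * ?s" using zF(1) by (rule quad_extE)
    have "z * \<sigma> z = b * b - c * c * of_int d"
      using d by (simp add: bc \<sigma>(2) algebra_simps)
    hence "z * \<sigma> z \<in> \<rat>" using bc by simp
    thus ?thesis
      using algebraic_int_mult[OF zF(2) algebraic_int_real_embedding[OF \<sigma>(1) F zF]]
        rational_algebraic_int_is_int by blast
  qed
  obtain v where v: "v \<in> ring_of_integers (quad_field d)" "u * v = 1"
    and uR: "u \<in> ring_of_integers (quad_field d)"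
    using u(1) by (auto simp: integer_units_def)
  have "\<sigma> u * \<sigma> v = 1"
    using real_embeddingD(2)[OF \<sigma>(1) F] real_embeddingD(4)[OF \<sigma>(1) F, of u v] v uR
    by (simp add: ring_of_integers_def)
  moreover have "(u * \<sigma> u) * (v * \<sigma> v) = (u * v) * (\<sigma> u * \<sigma> v)" by (simp only: mult_ac)
  ultimately have "(u * \<sigma> u) * (v * \<sigma> v) = 1" using v(2) by simp
  moreover obtain A B where AB: "u * \<sigma> u = of_int A" "v * \<sigma> v = of_int B"
    using norm_Ints[OF uR] norm_Ints[OF v(1)] by (auto elim!: Ints_cases)
  ultimately have "of_int (A * B) = (of_int 1 :: real)" by simp
  hence "A * B = 1" by (simp only: of_int_eq_iff)
  hence "A dvd 1" by (metis dvd_triv_left)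
  hence "\<bar>A\<bar> = 1" by simp
  hence "\<bar>u * \<sigma> u\<bar> = 1" unfolding AB(1) by linarith
  hence "\<bar>\<sigma> u\<bar> = 1 / u" using u(2) by (simp add: abs_mult field_simps)
  hence \<sigma>u: "\<bar>\<sigma> u\<bar> < 1" using u(2) by simp
  obtain b c where bc: "b \<in> \<rat>" "c \<in> \<rat>" "u = b + c * ?s"
    using uR by (auto simp: ring_of_integers_def elim: quad_extE)
  have bpos: "b > 0" and cpos: "c * ?s > 0"
    using \<sigma>u u(2) by (auto simp: bc \<sigma>(2))
  have "c > 0" using cpos d by (simp add: zero_less_mult_iff)
  have "algebraic_int (b + c * ?s)" using uR bc by (simp add: ring_of_integers_def)
  then obtain m k where mk: "2 * b = of_int m" "2 * c = of_int k" "4 dvd m\<^sup>2 - d * k\<^sup>2"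
    using quad_int_coeffs[OF d bc(1,2)] by blast
  have "of_int m > (0::real)" "of_int k > (0::real)" using mk(1,2) bpos \<open>c > 0\<close> by linarith+
  hence "m \<ge> 1" "k \<ge> 1" by simp_all
  moreover have "u = (of_int m + of_int k * ?s) / 2"
    unfolding bc(3) mk(1,2)[symmetric] by (simp add: algebra_simps)
  ultimately show ?thesis using that mk(3) by blast
qed

text \<open>\<open>\<eta>\<close> is a power of \<open>\<epsilon>\<close>; being above 1 makes the
  exponent positive, and being below the square of \<open>\<epsilon>\<close> leaves only exponent
  1.\<close>

lemma fundamental_unit_eqI:
  assumes \<epsilon>: "is_fundamental_unit F \<epsilon>" and \<eta>: "\<eta> \<in> integer_units F" "\<eta> > 1"
    and small: "\<And>u. u \<in> integer_units F \<Longrightarrow> u > 1 \<Longrightarrow> \<eta> < u * u"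
  shows "\<epsilon> = \<eta>"
proof -
  have e1: "\<epsilon> > 1" and eU: "\<epsilon> \<in> integer_units F"
    using \<epsilon> by (auto simp: is_fundamental_unit_def)
  obtain k :: int where "\<eta> = \<epsilon> powi k \<or> \<eta> = - (\<epsilon> powi k)"
    using \<epsilon> \<eta>(1) by (auto simp: is_fundamental_unit_def)
  moreover have "\<epsilon> powi k > 0" using e1 by simp
  ultimately have k: "\<eta> = \<epsilon> powi k" using \<eta>(2) by auto
  have "k > 0"
  proof (rule ccontr)
    assume "\<not> k > 0"
    hence "\<epsilon> powi k \<le> \<epsilon> powi 0" using e1 by (intro power_int_increasing) auto
    thus False using k \<eta>(2) by simp
  qed
  moreover have "k < 2"
  proof (rule ccontr)
    assume "\<not> k < 2"
    hence "\<epsilon> powi 2 \<le> \<epsilon> powi k" using e1 by (intro power_int_increasing) auto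
    thus False using k small[OF eU e1] by (simp add: power_int_def power2_eq_square)
  qed
  ultimately have "k = 1" by simp
  thus ?thesis using k by simp
qed

lemma root_of_square_minus_1:
  fixes s t z :: real
  assumes "s * s = t * t - 1" "z = t + s \<or> z = t - s"
  shows "z * z = 2 * t * z - 1"
  using assms by (auto simp: algebra_simps)

lemma root_of_square_minus_4:
  fixes s t z :: real
  assumes "s * s = t * t - 4" "z = (t + s) / 2 \<or> z = (t - s) / 2"
  shows "z * z = t * z - 1"
proof -
  have "s = 2 * z - t \<or> s = t - 2 * z" using assms(2) by (auto simp: field_simps)
  hence "(s - (2 * z - t)) * (s + (2 * z - t)) = 0" by auto
  thus ?thesis using assms(1) by (simp add: algebra_simps)
qed

lemma fundamental_unit_3_mod_4:
  fixes T d :: int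
  assumes d: "squarefree d" "d = T * T - 1" "T \<ge> 2" "d mod 4 = 3"
    and \<epsilon>: "is_fundamental_unit (quad_field d) \<epsilon>"
  shows "\<epsilon> = of_int T + sqrt (of_int d)"
proof (rule fundamental_unit_eqI[OF \<epsilon>])
  let ?s = "sqrt (of_int d)"
  have T4: "T * T \<ge> 2 * T" using d(3) by simp
  have d1: "d > 1" using d(2,3) T4 by linarith
  have ss: "?s * ?s = of_int d" using d1 by simp
  have s1: "?s > 1" using d1 by simp
  have ssT: "?s * ?s = of_int T * of_int T - 1" unfolding ss by (simp add: d(2))
  have roots: "z * z = of_int (2 * T) * z - of_int 1" if "z = of_int T + ?s \<or> z = of_int T - ?s" for z
    using root_of_square_minus_1[OF ssT that] by simp
  have inF: "of_int T + ?s \<in> quad_field d" "of_int T - ?s \<in> quad_field d"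
    using quad_extI[of "of_int T" \<rat> 1 ?s] quad_extI[of "of_int T" \<rat> "- 1" ?s] by auto
  have "(of_int T + ?s) * (of_int T - ?s) = 1" using ss by (simp add: d(2) algebra_simps)
  thus "of_int T + ?s \<in> integer_units (quad_field d)"
    using inF algebraic_int_quadratic[OF roots] unfolding integer_units_def ring_of_integers_def
    by blast
  show "of_int T + ?s > 1" using d(3) s1 by linarith
  fix u assume u: "u \<in> integer_units (quad_field d)" "u > 1"
  obtain m k where mk: "u = (of_int m + of_int k * ?s) / 2" "m \<ge> 1" "k \<ge> 1" "4 dvd m\<^sup>2 - d * k\<^sup>2"
    using integer_unit_gt_1[OF d(1) d1 u] .
  \<comment> \<open>Both coefficients are even, so every unit above 1 is at least
    \<open>1 + sqrt d\<close>, and its square already exceeds the candidate.\<close>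
  have "m \<ge> 2" "k \<ge> 2" using dvd4_3_mod_4[OF d(4) mk(4)] mk(2,3) by (presburger, presburger)
  hence "of_int k * ?s \<ge> 2 * ?s" "of_int m \<ge> (2::real)" using s1 by (auto intro!: mult_right_mono)
  hence "2 * u \<ge> 2 * (1 + ?s)" unfolding mk(1) by simp
  hence "u \<ge> 1 + ?s" by simp
  hence "u * u \<ge> (1 + ?s) * (1 + ?s)" using s1 u(2) by (intro mult_mono) auto
  also have "(1 + ?s) * (1 + ?s) = of_int (T * T) + 2 * ?s"
    using ss by (simp add: d(2) algebra_simps)
  finally have "u * u \<ge> of_int (T * T) + 2 * ?s" .
  moreover have "(of_int (T * T) :: real) \<ge> of_int T" using T4 d(3) by (subst of_int_le_iff) linarith
  ultimately show "of_int T + ?s < u * u" using s1 by linarith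
qed

lemma fundamental_unit_1_mod_4:
  fixes T d :: int
  assumes d: "squarefree d" "d = T * T - 4" "T \<ge> 4"
    and \<epsilon>: "is_fundamental_unit (quad_field d) \<epsilon>"
  shows "\<epsilon> = (of_int T + sqrt (of_int d)) / 2"
proof (rule fundamental_unit_eqI[OF \<epsilon>])
  let ?s = "sqrt (of_int d)"
  have T4: "T * T \<ge> 4 * T" using d(3) by simp
  have d1: "d > 1" using d(2,3) T4 by linarith
  have ss: "?s * ?s = of_int d" using d1 by simp
  have s1: "?s > 1" using d1 by simp
  have ssT: "?s * ?s = of_int T * of_int T - 4" unfolding ss by (simp add: d(2))
  have roots: "z * z = of_int T * z - of_int 1" if "z = (of_int T + ?s) / 2 \<or> z = (of_int T - ?s) / 2" for z
    using root_of_square_minus_4[OF ssT that] by simp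
  have inF: "(of_int T + ?s) / 2 \<in> quad_field d" "(of_int T - ?s) / 2 \<in> quad_field d"
    using quad_extI[of "of_int T / 2" \<rat> "1/2" ?s] quad_extI[of "of_int T / 2" \<rat> "- 1/2" ?s]
    by (auto simp: field_simps)
  have "(of_int T + ?s) / 2 * ((of_int T - ?s) / 2) = 1" using ss by (simp add: d(2) field_simps)
  thus "(of_int T + ?s) / 2 \<in> integer_units (quad_field d)"
    using inF algebraic_int_quadratic[OF roots] unfolding integer_units_def ring_of_integers_def
    by blast
  have "of_int T \<ge> (4::real)" using d(3) by simp
  hence "of_int T + ?s > 2" using s1 by linarith
  thus "(of_int T + ?s) / 2 > 1" by simp
  fix u assume u: "u \<in> integer_units (quad_field d)" "u > 1"
  obtain m k where mk: "u = (of_int m + of_int k * ?s) / 2" "m \<ge> 1" "k \<ge> 1"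
    using integer_unit_gt_1[OF d(1) d1 u] by metis
  \<comment> \<open>Half-integral coefficients can occur, so the lower bound for a unit above 1 is
    only \<open>(1 + sqrt d) / 2\<close>; for \<open>T \<ge> 4\<close> its square still
    suffices.\<close>
  have "of_int k * ?s \<ge> 1 * ?s" "of_int m \<ge> (1::real)" using mk s1 by (auto intro!: mult_right_mono)
  hence "2 * u \<ge> 1 + ?s" unfolding mk(1) by simp
  hence "(2 * u) * (2 * u) \<ge> (1 + ?s) * (1 + ?s)" using s1 u(2) by (intro mult_mono) auto
  also have "(1 + ?s) * (1 + ?s) = of_int (T * T) - 3 + 2 * ?s"
    using ss by (simp add: d(2) algebra_simps)
  finally have "4 * (u * u) \<ge> of_int (T * T) - 3 + 2 * ?s" by simp
  moreover have "(of_int (T * T) :: real) \<ge> of_int (4 * T)" using T4 by (subst of_int_le_iff)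
  hence "(of_int (T * T) :: real) \<ge> 4 * of_int T" by simp
  moreover have "of_int T \<ge> (4::real)" using d(3) by simp
  moreover have "t + s < 2 * v" if "w - 3 + 2 * s \<le> 4 * v" "4 * t \<le> w" "4 \<le> t" for s t v w :: real
    using that by linarith
  ultimately have "of_int T + ?s < 2 * (u * u)" by blast
  thus "(of_int T + ?s) / 2 < u * u" by (simp add: field_simps)
qed

section \<open>Lattice points in the cone over the large facet\<close>

text \<open>
  A vector \<open>(u, v, i, j)\<close> stands for \<open>w (P - Q / y)\<close> with \<open>P = u + v x\<close> and \<open>Q = i + j x\<close>. The generators
  are the lattice points of the large facet: a hexagon in the layer \<open>(i, j) = (1, 0)\<close> and its mirror
  image under \<open>(u, v, i, j) \<mapsto> (v, u, j, i)\<close> in the layer \<open>(0, 1)\<close>.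
\<close>

inductive facet_cone :: "int \<Rightarrow> int \<Rightarrow> int \<Rightarrow> int \<Rightarrow> int \<Rightarrow> bool" for a :: int where
  zero: "facet_cone a 0 0 0 0"
| add: "facet_cone a u v i j \<Longrightarrow> facet_cone a u' v' i' j' \<Longrightarrow>
    facet_cone a (u + u') (v + v') (i + i') (j + j')"
| P_row: "1 \<le> t \<Longrightarrow> t \<le> a \<Longrightarrow> facet_cone a t 0 1 0"
| P_bottom: "\<delta> \<in> {0, 1} \<Longrightarrow> facet_cone a (a + \<delta>) (- 1) 1 0"
| P_top: "\<delta> \<in> {0, 1} \<Longrightarrow> facet_cone a \<delta> 1 1 0"
| Q_row: "1 \<le> t \<Longrightarrow> t \<le> a \<Longrightarrow> facet_cone a 0 t 0 1"
| Q_bottom: "\<delta> \<in> {0, 1} \<Longrightarrow> facet_cone a (- 1) (a + \<delta>) 0 1"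
| Q_top: "\<delta> \<in> {0, 1} \<Longrightarrow> facet_cone a 1 \<delta> 0 1"

lemma facet_cone_cong:
  "facet_cone a u v i j \<Longrightarrow> u = u' \<Longrightarrow> v = v' \<Longrightarrow> i = i' \<Longrightarrow> j = j' \<Longrightarrow> facet_cone a u' v' i' j'"
  by simp

lemma facet_cone_swap: "facet_cone a u v i j \<Longrightarrow> facet_cone a v u j i"
  by (induction rule: facet_cone.induct) (auto intro: facet_cone.intros)

text \<open>This is the central symmetry of the two hexagons. It mirrors the invariance of
  \<open>Q / y < P < Q y\<close> under \<open>P \<mapsto> (a + 1) Q - P\<close>, which holds as
  \<open>y + 1 / y = a + 1\<close>.\<close>

lemma facet_cone_reflect:
  "facet_cone a u v i j \<Longrightarrow> facet_cone a ((a + 1) * i - u) ((a + 1) * j - v) i j"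
proof (induction rule: facet_cone.induct)
  case (add u v i j u' v' i' j')
  show ?case by (rule facet_cone_cong[OF facet_cone.add[OF add.IH]]) (simp_all add: algebra_simps)
next
  case (P_row t)
  show ?case by (rule facet_cone_cong[OF facet_cone.P_row[of "a + 1 - t"]]) (use P_row in auto)
next
  case (P_bottom \<delta>)
  show ?case by (rule facet_cone_cong[OF facet_cone.P_top[of "1 - \<delta>"]]) (use P_bottom in auto)
next
  case (P_top \<delta>)
  show ?case by (rule facet_cone_cong[OF facet_cone.P_bottom[of "1 - \<delta>"]]) (use P_top in auto)
next
  case (Q_row t)
  show ?case by (rule facet_cone_cong[OF facet_cone.Q_row[of "a + 1 - t"]]) (use Q_row in auto)
next
  case (Q_bottom \<delta>)
  show ?case by (rule facet_cone_cong[OF facet_cone.Q_top[of "1 - \<delta>"]]) (use Q_bottom in auto)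
next
  case (Q_top \<delta>)
  show ?case by (rule facet_cone_cong[OF facet_cone.Q_bottom[of "1 - \<delta>"]]) (use Q_top in auto)
qed (simp add: facet_cone.zero)

lemma facet_cone_scale:
  assumes "facet_cone a u v i j" "k \<ge> 0"
  shows "facet_cone a (k * u) (k * v) (k * i) (k * j)"
proof -
  have "facet_cone a (int m * u) (int m * v) (int m * i) (int m * j)" for m
  proof (induction m)
    case (Suc m)
    show ?case
      by (rule facet_cone_cong[OF facet_cone.add[OF assms(1) Suc]]) (simp_all add: algebra_simps)
  qed (simp add: facet_cone.zero)
  from this[of "nat k"] show ?thesis using assms(2) by simp
qed

lemma facet_cone_row:
  assumes a: "1 \<le> a" and "0 \<le> m" "m \<le> T" "T \<le> a * m"
  shows "facet_cone a T 0 m 0"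
proof -
  have "facet_cone a T 0 (int k) 0" if "int k \<le> T" "T \<le> a * int k" for k T
    using that
  proof (induction k arbitrary: T)
    case (Suc k)
    \<comment> \<open>Greedy choice: the least entry in the row for which the remainder is at most
      \<open>a * k\<close>; the remainder is then still at least \<open>k\<close>.\<close>
    define t where "t = max 1 (T - a * int k)"
    have "1 \<le> t" "t \<le> a" using Suc.prems a by (auto simp: t_def algebra_simps)
    moreover have "facet_cone a (T - t) 0 (int k) 0"
      using Suc.prems mult_right_mono[OF a, of "int k"]
      by (intro Suc.IH) (auto simp: t_def algebra_simps)
    ultimately show ?case
      using facet_cone.add[OF facet_cone.P_row, of t a "T - t" 0 "int k" 0] by simp
  qed (simp add: facet_cone.zero)
  from this[of "nat m" T] show ?thesis using assms by simp
qed

text \<open>The points \<open>(1, 0, 1, 0)\<close>, \<open>(0, 1, 1, 0)\<close> and, for negative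
  \<open>u\<close>, \<open>(- 1, a, 0, 1)\<close> account for \<open>u\<close> and \<open>i\<close>.
  What remains is a row of the second layer, and the last two assumptions are its lower bound in the
  two cases.\<close>

lemma facet_cone_left_low:
  assumes a: "1 \<le> a" and "0 \<le> i" "0 \<le> j" "u < i" "v \<le> a * j" "- j \<le> u"
    and "i + j \<le> u + v" "i + j \<le> (a - 1) * u + v"
  shows "facet_cone a u v i j"
proof (cases "u \<ge> 0")
  case True
  have 1: "facet_cone a (u * 1) (u * 0) (u * 1) (u * 0)"
    by (rule facet_cone_scale[OF facet_cone.P_row]) (use True a in auto)
  have 2: "facet_cone a ((i - u) * 0) ((i - u) * 1) ((i - u) * 1) ((i - u) * 0)"
    by (rule facet_cone_scale[OF facet_cone.P_top]) (use assms in auto)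
  have 3: "facet_cone a (v - (i - u)) 0 j 0"
    by (rule facet_cone_row[OF a]) (use assms True in auto)
  show ?thesis
    by (rule facet_cone_cong[OF facet_cone.add[OF facet_cone.add[OF 1 2] facet_cone_swap[OF 3]]])
       simp_all
next
  case False
  have 1: "facet_cone a (i * 0) (i * 1) (i * 1) (i * 0)"
    by (rule facet_cone_scale[OF facet_cone.P_top]) (use assms in auto)
  have 2: "facet_cone a (- u * - 1) (- u * (a + 0)) (- u * 0) (- u * 1)"
    by (rule facet_cone_scale[OF facet_cone.Q_bottom]) (use False in auto)
  have 3: "facet_cone a (v - i + a * u) 0 (j + u) 0"
    by (rule facet_cone_row[OF a]) (use assms False in \<open>auto simp: algebra_simps\<close>)
  show ?thesis
    by (rule facet_cone_cong[OF facet_cone.add[OF facet_cone.add[OF 1 2] facet_cone_swap[OF 3]]])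
       (simp_all add: algebra_simps)
qed

text \<open>\<open>k\<close> is the deficit of the first coordinate below \<open>i\<close>, and
  \<open>l\<close> the excess of the second above \<open>a * j\<close>. Points with first coordinate
  -1 supply the deficit; \<open>(1, 1, 1, 0)\<close> and \<open>(- 1, a + 1, 0, 1)\<close> supply
  the excess.\<close>

lemma facet_cone_corner:
  assumes a: "a \<ge> 2" and "0 \<le> i" "0 \<le> k" "k \<le> j" "0 \<le> l" "l \<le> i + j"
    and "l - k \<le> (a - 1) * i" "(a - 1) * l \<le> (a - 1) * i + (a - 2) * j + k"
  shows "facet_cone a (i - k) (a * j + l) i j"
proof (cases "l \<le> i + k")
  case True
  define p where "p = min l i"
  define q where "q = l - p"
  have pq: "0 \<le> p" "p \<le> i" "0 \<le> q" "q \<le> k" "l = p + q"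
    using assms True by (auto simp: p_def q_def)
  have 1: "facet_cone a (p * 1) (p * 1) (p * 1) (p * 0)"
    by (rule facet_cone_scale[OF facet_cone.P_top]) (use pq in auto)
  have 2: "facet_cone a ((i - p) * 1) ((i - p) * 0) ((i - p) * 1) ((i - p) * 0)"
    by (rule facet_cone_scale[OF facet_cone.P_row]) (use pq a in auto)
  have 3: "facet_cone a (q * - 1) (q * (a + 1)) (q * 0) (q * 1)"
    by (rule facet_cone_scale[OF facet_cone.Q_bottom]) (use pq in auto)
  have 4: "facet_cone a ((k - q) * - 1) ((k - q) * (a + 0)) ((k - q) * 0) ((k - q) * 1)"
    by (rule facet_cone_scale[OF facet_cone.Q_bottom]) (use pq in auto)
  have 5: "facet_cone a ((j - k) * 0) ((j - k) * a) ((j - k) * 0) ((j - k) * 1)"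
    by (rule facet_cone_scale[OF facet_cone.Q_row]) (use assms in auto)
  note sum = facet_cone.add[OF facet_cone.add[OF facet_cone.add[OF facet_cone.add[OF 1 2] 3] 4] 5]
  show ?thesis
    by (rule facet_cone_cong[OF sum]) (use pq(5) in \<open>simp_all add: algebra_simps\<close>)
next
  case False
  \<comment> \<open>The excess now requires more than \<open>k\<close> points with first coordinate
    -1. A row of \<open>p\<close> points balances them, and the two entries of the minimum match the
    last two assumptions, which bound the sum of that row by \<open>a * p\<close>.\<close>
  define p where "p = min i (i + j - l)"
  define q where "q = l - i + p"
  have pq: "0 \<le> p" "p \<le> i" "0 \<le> q" "q \<le> j"
    using assms False by (auto simp: p_def q_def)
  have T: "l - i - k \<le> (a - 2) * p"
    using assms by (auto simp: p_def min_def algebra_simps)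
  have 1: "facet_cone a (l - i - k + 2 * p) 0 p 0"
    by (rule facet_cone_row) (use a pq False T in \<open>auto simp: algebra_simps\<close>)
  have 2: "facet_cone a ((i - p) * 1) ((i - p) * 1) ((i - p) * 1) ((i - p) * 0)"
    by (rule facet_cone_scale[OF facet_cone.P_top]) (use pq in auto)
  have 3: "facet_cone a (q * - 1) (q * (a + 1)) (q * 0) (q * 1)"
    by (rule facet_cone_scale[OF facet_cone.Q_bottom]) (use pq in auto)
  have 4: "facet_cone a ((j - q) * 0) ((j - q) * a) ((j - q) * 0) ((j - q) * 1)"
    by (rule facet_cone_scale[OF facet_cone.Q_row]) (use pq a in auto)
  note sum = facet_cone.add[OF facet_cone.add[OF facet_cone.add[OF 1 2] 3] 4]
  show ?thesis
    by (rule facet_cone_cong[OF sum]) (simp_all add: q_def algebra_simps)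
qed

text \<open>
  One inequality for each of the twelve neighbours of the large facet. The bounds on \<open>u\<close> and \<open>v\<close> alone
  come from translates of the simplex, the others from translates by \<open>x\<^sup>r y\<^sup>s\<close> with \<open>\<bar>r\<bar>, \<bar>s\<bar> \<le> 1\<close>.
\<close>

definition facet_ineqs :: "int \<Rightarrow> int \<Rightarrow> int \<Rightarrow> int \<Rightarrow> int \<Rightarrow> bool" where
  "facet_ineqs a u v i j \<longleftrightarrow> 0 \<le> i \<and> 0 \<le> j \<and>
     - i \<le> v \<and> v \<le> i + (a + 1) * j \<and> - j \<le> u \<and> u \<le> j + (a + 1) * i \<and>
     i + j \<le> u + v \<and> u + v \<le> a * (i + j) \<and>
     i + j \<le> u + (a - 1) * v \<and> u + (a - 1) * v \<le> a * i + (a * a - 2) * j \<and>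
     i + j \<le> (a - 1) * u + v \<and> (a - 1) * u + v \<le> (a * a - 2) * i + a * j"

lemma facet_ineqs_swap: "facet_ineqs a u v i j \<Longrightarrow> facet_ineqs a v u j i"
  by (auto simp: facet_ineqs_def algebra_simps)

lemma facet_ineqs_reflect:
  "facet_ineqs a u v i j \<Longrightarrow> facet_ineqs a ((a + 1) * i - u) ((a + 1) * j - v) i j"
  by (auto simp: facet_ineqs_def algebra_simps)

lemma facet_cone_left:
  assumes a: "a \<ge> 2" and R: "facet_ineqs a u v i j" and u: "u < i"
  shows "facet_cone a u v i j"
proof (cases "v \<le> a * j")
  case True
  thus ?thesis using a R u by (intro facet_cone_left_low) (auto simp: facet_ineqs_def)
next
  case False
  \<comment> \<open>The corner \<open>u < i\<close>, \<open>v > a j\<close> is mapped to itself by reflection followed by the swap, which exchanges \<open>k\<close> and \<open>l\<close>.\<close>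
  define k where "k = i - u"
  define l where "l = v - a * j"
  have uv: "u = i - k" "v = a * j + l" by (auto simp: k_def l_def)
  have kl: "0 < k" "0 < l" using u False by (auto simp: k_def l_def)
  have R': "0 \<le> i" "0 \<le> j" "l \<le> i + j" "k \<le> i + j" "l - k \<le> (a - 1) * i"
    "(a - 1) * l \<le> (a - 1) * i + (a - 2) * j + k" "k - l \<le> (a - 1) * j"
    "(a - 1) * k \<le> (a - 1) * j + (a - 2) * i + l"
    using R unfolding facet_ineqs_def uv by (auto simp: algebra_simps)
  consider "k \<le> j" | "l \<le> i" | "j < k" "i < l" by linarith
  thus ?thesis
  proof cases
    case 1
    thus ?thesis unfolding uv using a kl R' by (intro facet_cone_corner) auto
  next
    case 2
    have "facet_cone a (j - l) (a * i + k) j i"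
      using a kl R' 2 by (intro facet_cone_corner) (auto simp: algebra_simps)
    from facet_cone_reflect[OF facet_cone_swap[OF this]] show ?thesis
      unfolding uv by (rule facet_cone_cong) (simp_all add: algebra_simps)
  next
    case 3
    \<comment> \<open>Here the top edge of the first hexagon and the bottom edge of the second
      suffice; \<open>e\<close> and \<open>l - i\<close> count how often the left end of the former
      and the right end \<open>(- 1, a + 1)\<close> of the latter occur.\<close>
    define e where "e = k - j"
    have 1: "facet_cone a (e * 0) (e * 1) (e * 1) (e * 0)"
      by (rule facet_cone_scale[OF facet_cone.P_top]) (use 3 in \<open>auto simp: e_def\<close>)
    have 2: "facet_cone a ((i - e) * 1) ((i - e) * 1) ((i - e) * 1) ((i - e) * 0)"
      by (rule facet_cone_scale[OF facet_cone.P_top]) (use R' in \<open>auto simp: e_def\<close>)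
    have 3: "facet_cone a ((l - i) * - 1) ((l - i) * (a + 1)) ((l - i) * 0) ((l - i) * 1)"
      by (rule facet_cone_scale[OF facet_cone.Q_bottom]) (use 3 in auto)
    have 4: "facet_cone a ((j - l + i) * - 1) ((j - l + i) * (a + 0)) ((j - l + i) * 0) ((j - l + i) * 1)"
      by (rule facet_cone_scale[OF facet_cone.Q_bottom]) (use R' in auto)
    note sum = facet_cone.add[OF facet_cone.add[OF facet_cone.add[OF 1 2] 3] 4]
    show ?thesis
      unfolding uv by (rule facet_cone_cong[OF sum]) (simp_all add: e_def algebra_simps)
  qed
qed

lemma facet_cone_if_facet_ineqs:
  assumes a: "a \<ge> 2" and R: "facet_ineqs a u v i j"
  shows "facet_cone a u v i j"
proof -
  note reflect = facet_cone_reflect[of a "(a + 1) * i - u" "(a + 1) * j - v" i j, simplified]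
  \<comment> \<open>Where both coordinates lie in the range of the rows, two rows suffice; swap and
    reflection carry every other case to \<open>u < i\<close>.\<close>
  consider "u < i" | "a * i < u" | "v < j" | "a * j < v"
    | "i \<le> u" "u \<le> a * i" "j \<le> v" "v \<le> a * j" by linarith
  thus ?thesis
  proof cases
    case 1
    show ?thesis by (rule facet_cone_left[OF a R 1])
  next
    case 2
    show ?thesis
      by (rule reflect, rule facet_cone_left[OF a facet_ineqs_reflect[OF R]])
         (use 2 in \<open>simp add: algebra_simps\<close>)
  next
    case 3
    show ?thesis by (rule facet_cone_swap, rule facet_cone_left[OF a facet_ineqs_swap[OF R] 3])
  next
    case 4
    show ?thesis
      by (rule reflect, rule facet_cone_swap,
          rule facet_cone_left[OF a facet_ineqs_swap[OF facet_ineqs_reflect[OF R]]])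
         (use 4 in \<open>simp add: algebra_simps\<close>)
  next
    case 5
    have 1: "facet_cone a u 0 i 0" and 2: "facet_cone a v 0 j 0"
      using a 5 R by (auto simp: facet_ineqs_def intro!: facet_cone_row)
    show ?thesis
      by (rule facet_cone_cong[OF facet_cone.add[OF 1 facet_cone_swap[OF 2]]]) simp_all
  qed
qed

section \<open>Reduction of totally positive elements\<close>

type_synonym quad = "int \<times> int \<times> int \<times> int"

text \<open>This isolates the part that depends only on two units of norm 1 with traces
  \<open>a\<close> and \<open>a + 1\<close>; the number field enters later.\<close>

locale positive_cone =
  fixes a :: int and x y :: real
  assumes a_ge: "a \<ge> 3" and x_gt: "1 < x" and y_gt: "x < y"
    and xx: "x * x = a * x - 1" and yy: "y * y = (a + 1) * y - 1"
begin

abbreviation x' :: real where "x' \<equiv> of_int a - x"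
abbreviation y' :: real where "y' \<equiv> of_int a + 1 - y"

text \<open>
  The four pairs of values of \<open>(x, y)\<close> under the embeddings of the biquadratic field.
\<close>

definition places :: "(real \<times> real) set" where
  "places = {x, x'} \<times> {y, y'}"

text \<open>The conjugate of \<open>w (P - Q / y)\<close> at a place, where
  \<open>of_int a + 1 - Y\<close> is the inverse of \<open>Y\<close>.\<close>

definition elt :: "real \<times> real \<Rightarrow> quad \<Rightarrow> real" where
  "elt P q = (case P of (X, Y) \<Rightarrow> case q of (u, v, i, j) \<Rightarrow>
     (X * Y - 1) * (of_int u + of_int v * X - (of_int i + of_int j * X) * (of_int a + 1 - Y)))"

text \<open>These are the conjugates of \<open>w^2 / (x y)\<close>, the unit that becomes
  \<open>\<epsilon>\<^sub>r\<close>. Its image \<open>e'\<close> under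
  \<open>X \<mapsto> a - X\<close> turns out to be its inverse.\<close>

definition e :: "real \<times> real \<Rightarrow> real" where
  "e P = (case P of (X, Y) \<Rightarrow> X * Y + (of_int a - X) * (of_int a + 1 - Y) - 2)"

definition e' :: "real \<times> real \<Rightarrow> real" where
  "e' P = (case P of (X, Y) \<Rightarrow> (of_int a - X) * Y + X * (of_int a + 1 - Y) - 2)"

definition tp :: "quad \<Rightarrow> bool" where
  "tp q \<longleftrightarrow> (\<forall>P\<in>places. elt P q > 0)"

lemma places_rel:
  fixes X Y :: real
  assumes "(X, Y) \<in> places"
  shows "X * X = a * X - 1" "Y * Y = (a + 1) * Y - 1"
proof -
  have "x' * x' = a * x' - 1" "y' * y' = (of_int a + 1) * y' - 1"
    using xx yy[simplified of_int_add of_int_1] by Groebner_Basis.algebra+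
  thus "X * X = a * X - 1" "Y * Y = (a + 1) * Y - 1"
    using assms xx yy by (auto simp: places_def)
qed

lemma x'_eq: "x * x' = 1" and y'_eq: "y * y' = 1"
  using xx yy by (simp_all add: algebra_simps)

lemma conj_bounds: "0 < x'" "x' < 1" "0 < y'" "y' < x'"
proof -
  have x0: "0 < x" "0 < y" using x_gt y_gt by auto
  have x': "x' = 1 / x" and y': "y' = 1 / y"
    using x'_eq y'_eq x0 by (simp_all add: field_simps)
  show "0 < x'" "x' < 1" "0 < y'" "y' < x'"
    unfolding x' y' using x_gt y_gt x0 by (simp_all add: divide_strict_left_mono)
qed

lemma places_pos:
  fixes X Y :: real
  shows "(X, Y) \<in> places \<Longrightarrow> X > 0 \<and> Y > 0 \<and> a - X > 0 \<and> of_int a + 1 - Y > 0"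
  using conj_bounds x_gt y_gt by (auto simp: places_def)

text \<open>Both \<open>x\<close> and \<open>x'\<close> lie strictly between \<open>y'\<close> and
  \<open>y\<close>, so the second coordinate of the place decides the sign.\<close>

lemma w_sign:
  "x * y - 1 > 0" "x' * y - 1 > 0" "x * y' - 1 < 0" "x' * y' - 1 < 0"
proof -
  have "x * y > x * 1" using x_gt y_gt by (intro mult_strict_left_mono) auto
  thus "x * y - 1 > 0" using x_gt by linarith
  have "x' * y > x' * x" using conj_bounds y_gt by (intro mult_strict_left_mono) auto
  thus "x' * y - 1 > 0" using x'_eq by (simp add: mult.commute)
  have "x * y' < x * x'" using conj_bounds x_gt by (intro mult_strict_left_mono) auto
  thus "x * y' - 1 < 0" using x'_eq by simp
  have "x' * y' < 1 * 1" using conj_bounds by (intro mult_strict_mono) auto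
  thus "x' * y' - 1 < 0" by simp
qed

lemma w_nz:
  fixes X Y :: real
  shows "(X, Y) \<in> places \<Longrightarrow> X * Y \<noteq> 1" "(X, Y) \<in> places \<Longrightarrow> (a - X) * Y \<noteq> 1"
  using w_sign by (auto simp: places_def)

lemma e_eq:
  fixes X Y :: real
  assumes "(X, Y) \<in> places" shows "e (X, Y) = (X * Y - 1)\<^sup>2 * ((a - X) * (of_int a + 1 - Y))"
  using places_rel[OF assms] unfolding e_def power2_eq_square by simp Groebner_Basis.algebra

lemma e'_eq:
  fixes X Y :: real
  assumes "(X, Y) \<in> places" shows "e' (X, Y) = ((a - X) * Y - 1)\<^sup>2 * (X * (of_int a + 1 - Y))"
  using places_rel[OF assms] unfolding e'_def power2_eq_square by simp Groebner_Basis.algebra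

text \<open>Expanding with \<open>X (a - X) = 1\<close> and \<open>Y (a + 1 - Y) = 1\<close> leaves
  the square of the difference of the two traces, which is 1.\<close>

lemma e_e'_eq:
  fixes X Y :: real
  assumes "(X, Y) \<in> places" shows "e (X, Y) * e' (X, Y) = 1"
  using places_rel[OF assms] unfolding e_def e'_def by simp Groebner_Basis.algebra

lemma e_pos: "(X, Y) \<in> places \<Longrightarrow> e (X, Y) > 0"
  using w_nz(1) places_pos by (simp add: e_eq)

lemma e'_pos: "(X, Y) \<in> places \<Longrightarrow> e' (X, Y) > 0"
  using w_nz(2) places_pos by (simp add: e'_eq)

section \<open>Multiplication by units in coordinates\<close>

fun qadd :: "quad \<Rightarrow> quad \<Rightarrow> quad" where
  "qadd (u, v, i, j) (u', v', i', j') = (u + u', v + v', i + i', j + j')"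

fun qdbl :: "quad \<Rightarrow> quad" where
  "qdbl (u, v, i, j) = (2 * u, 2 * v, 2 * i, 2 * j)"

fun qsub :: "quad \<Rightarrow> quad \<Rightarrow> quad" where
  "qsub (u, v, i, j) (u', v', i', j') = (u - u', v - v', i - i', j - j')"

text \<open>\<open>mx\<close>, \<open>mx'\<close>, \<open>my\<close>, \<open>my'\<close> multiply by
  \<open>x\<close>, \<open>1 / x\<close>, \<open>y\<close>, \<open>1 / y\<close>; for instance
  \<open>y (P - Q / y) = ((a + 1) P - Q) - P / y\<close>.\<close>

fun mx :: "quad \<Rightarrow> quad" where
  "mx (u, v, i, j) = (- v, u + a * v, - j, i + a * j)"

fun mx' :: "quad \<Rightarrow> quad" where
  "mx' (u, v, i, j) = (a * u + v, - u, a * i + j, - i)"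

fun my :: "quad \<Rightarrow> quad" where
  "my (u, v, i, j) = ((a + 1) * u - i, (a + 1) * v - j, u, v)"

fun my' :: "quad \<Rightarrow> quad" where
  "my' (u, v, i, j) = (i, j, (a + 1) * i - u, (a + 1) * j - v)"

definition me :: "quad \<Rightarrow> quad" where
  "me q = qsub (qadd (mx (my q)) (mx' (my' q))) (qdbl q)"

definition me' :: "quad \<Rightarrow> quad" where
  "me' q = qsub (qadd (mx' (my q)) (mx (my' q))) (qdbl q)"

lemma elt_lin:
  "elt P (qadd q r) = elt P q + elt P r" "elt P (qsub q r) = elt P q - elt P r"
  "elt P (qdbl q) = 2 * elt P q"
  by (cases P; cases q; cases r; simp add: elt_def algebra_simps)+

lemma elt_m:
  fixes X Y :: real
  assumes "(X, Y) \<in> places"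
  shows "elt (X, Y) (mx q) = X * elt (X, Y) q" "elt (X, Y) (mx' q) = (a - X) * elt (X, Y) q"
    "elt (X, Y) (my q) = Y * elt (X, Y) q" "elt (X, Y) (my' q) = (of_int a + 1 - Y) * elt (X, Y) q"
proof -
  obtain u v i j where q: "q = (u, v, i, j)" by (metis surj_pair)
  note rel = places_rel[OF assms]
  show "elt (X, Y) (mx q) = X * elt (X, Y) q" using rel by (simp add: q elt_def) Groebner_Basis.algebra
  show "elt (X, Y) (mx' q) = (a - X) * elt (X, Y) q" using rel by (simp add: q elt_def) Groebner_Basis.algebra
  show "elt (X, Y) (my q) = Y * elt (X, Y) q" using rel by (simp add: q elt_def) Groebner_Basis.algebra
  show "elt (X, Y) (my' q) = (of_int a + 1 - Y) * elt (X, Y) q" using rel by (simp add: q elt_def) Groebner_Basis.algebra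
qed

lemma elt_me:
  fixes X Y :: real
  assumes "(X, Y) \<in> places"
  shows "elt (X, Y) (me q) = e (X, Y) * elt (X, Y) q" "elt (X, Y) (me' q) = e' (X, Y) * elt (X, Y) q"
  by (simp_all add: me_def me'_def elt_lin elt_m[OF assms] e_def e'_def algebra_simps)

text \<open>\<open>m\<close> is multiplication, in coordinates, by the totally positive element
  whose conjugates are the values of \<open>g\<close>.\<close>

definition unit_mult :: "(quad \<Rightarrow> quad) \<Rightarrow> (real \<times> real \<Rightarrow> real) \<Rightarrow> bool" where
  "unit_mult m g \<longleftrightarrow> (\<forall>P\<in>places. g P > 0 \<and> (\<forall>q. elt P (m q) = g P * elt P q))"

lemma unit_multI:
  assumes "\<And>X Y q. (X, Y) \<in> places \<Longrightarrow> g (X, Y) > 0"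
    and "\<And>X Y q. (X, Y) \<in> places \<Longrightarrow> elt (X, Y) (m q) = g (X, Y) * elt (X, Y) q"
  shows "unit_mult m g"
  unfolding unit_mult_def
proof (intro ballI conjI allI)
  fix P q assume "P \<in> places"
  thus "g P > 0" "elt P (m q) = g P * elt P q" using assms by (cases P; blast)+
qed

lemma unit_multD:
  assumes "unit_mult m g" "P \<in> places"
  shows "g P > 0" "elt P (m q) = g P * elt P q"
  using assms unfolding unit_mult_def by blast+

lemma unit_mults:
  "unit_mult mx fst" "unit_mult mx' (\<lambda>P. a - fst P)"
  "unit_mult my snd" "unit_mult my' (\<lambda>P. of_int a + 1 - snd P)"
  "unit_mult me e" "unit_mult me' e'"
  using places_pos by (auto intro!: unit_multI simp only: elt_m elt_me e_pos e'_pos fst_conv snd_conv)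

lemma unit_mult_comp:
  assumes "unit_mult m g" "unit_mult m' g'"
  shows "unit_mult (\<lambda>q. m (m' q)) (\<lambda>P. g P * g' P)"
  by (rule unit_multI) (simp_all only: unit_multD[OF assms(1)] unit_multD[OF assms(2)] mult.assoc mult_pos_pos)

lemma unit_mult_tp: "unit_mult m g \<Longrightarrow> tp q \<Longrightarrow> tp (m q)"
  unfolding tp_def by (metis unit_multD mult_pos_pos)

text \<open>
  The two functionals that are constantly 1 on the large facet and on the simplex \<open>1, x, y, x y\<close>,
  respectively; see \<open>lA_coord\<close> below for the latter.
\<close>

fun lB :: "quad \<Rightarrow> int" where "lB (u, v, i, j) = i + j"

fun lA :: "quad \<Rightarrow> int" where "lA (u, v, i, j) = i + j + (a - 2) * (v + i)"

lemma lB_pos: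
  assumes "tp q" shows "lB q > 0"
proof -
  obtain u v i j where q: "q = (u, v, i, j)" by (metis surj_pair)
  \<comment> \<open>As \<open>w\<close> is positive at \<open>(X, y)\<close> and negative at
    \<open>(X, y')\<close>, the two conjugates give \<open>Q y' < P < Q y\<close>, hence
    \<open>Q > 0\<close> at \<open>X\<close>.\<close>
  have Q: "i + j * X > 0" if X: "(X, y) \<in> places" "X * y - 1 > 0" "X * y' - 1 < 0" for X :: real
  proof -
    have "elt (X, y) q > 0" "elt (X, y') q > 0"
      using assms X by (auto simp: tp_def places_def)
    hence "u + v * X - (i + j * X) * y' > 0" "u + v * X - (i + j * X) * y < 0"
      using X by (auto simp: q elt_def zero_less_mult_iff)
    hence "(i + j * X) * (y - y') > 0" by (simp add: algebra_simps)
    moreover have "y - y' > 0" using conj_bounds x_gt y_gt by linarith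
    ultimately show ?thesis by (simp add: zero_less_mult_iff)
  qed
  have "i + j * x > 0" "i + j * x' > 0" using Q w_sign by (auto simp: places_def)
  moreover have "1 - x' > 0" "x - 1 > 0" using conj_bounds x_gt by auto
  \<comment> \<open>\<open>lB\<close> is the value of \<open>Q\<close> at 1, which lies between
    \<open>x'\<close> and \<open>x\<close>, so it is a positive combination of the values
    there.\<close>
  ultimately have "(i + j * x) * (1 - x') + (i + j * x') * (x - 1) > 0"
    using add_pos_pos mult_pos_pos by blast
  also have "(i + j * x) * (1 - x') + (i + j * x') * (x - 1) = (i + j) * (x - x')"
    by (simp add: algebra_simps)
  finally have "real_of_int (i + j) > 0"
    by (rule zero_less_mult_pos2) (use conj_bounds x_gt in linarith)
  thus ?thesis by (simp add: q)
qed

text \<open>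
  Coordinates with respect to the basis \<open>1, x, y, x y\<close>.
\<close>

fun coord :: "quad \<Rightarrow> quad" where
  "coord (u, v, i, j) = (- u + j + (a + 1) * i, - v - i + j, - v - i, u + a * v - j)"

lemma elt_coord:
  fixes X Y :: real
  assumes "(X, Y) \<in> places" "coord q = (c0, c1, c2, c3)"
  shows "elt (X, Y) q = c0 + c1 * X + c2 * Y + c3 * (X * Y)"
proof -
  obtain u v i j where q: "q = (u, v, i, j)" by (metis surj_pair)
  have c: "c0 = - u + j + (a + 1) * i" "c1 = - v - i + j" "c2 = - v - i" "c3 = u + a * v - j"
    using assms(2) by (auto simp: q)
  show ?thesis using places_rel[OF assms(1)] unfolding c by (simp add: q elt_def) Groebner_Basis.algebra
qed

lemma lA_coord: "coord q = (c0, c1, c2, c3) \<Longrightarrow> lA q = c0 + c1 + c2 + c3"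
  by (cases q rule: coord.cases) (auto simp: algebra_simps)

lemma lA_pos:
  assumes "tp q" shows "lA q > 0"
proof -
  obtain c0 c1 c2 c3 where c: "coord q = (c0, c1, c2, c3)" by (metis surj_pair)
  have "elt (x, y) q > 0" "elt (x', y) q > 0" "elt (x, y') q > 0" "elt (x', y') q > 0"
    using assms by (auto simp: tp_def places_def)
  moreover have "1 - x' > 0" "x - 1 > 0" "1 - y' > 0" "y - 1 > 0"
    using conj_bounds x_gt y_gt by auto
  \<comment> \<open>Bilinear interpolation: by \<open>lA_coord\<close> the functional is the value
    at \<open>X = Y = 1\<close> of the form with coefficients \<open>c0\<close> to
    \<open>c3\<close>, and 1 lies between the conjugates in either variable.\<close>
  ultimately have "elt (x, y) q * ((1 - x') * (1 - y')) + elt (x', y) q * ((x - 1) * (1 - y'))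
    + elt (x, y') q * ((1 - x') * (y - 1)) + elt (x', y') q * ((x - 1) * (y - 1)) > 0"
    by (intro add_pos_pos mult_pos_pos)
  also have "elt (x, y) q * ((1 - x') * (1 - y')) + elt (x', y) q * ((x - 1) * (1 - y'))
    + elt (x, y') q * ((1 - x') * (y - 1)) + elt (x', y') q * ((x - 1) * (y - 1))
    = (c0 + c1 + c2 + c3) * ((x - x') * (y - y'))"
    by (simp add: elt_coord[OF _ c] places_def) Groebner_Basis.algebra
  finally have "real_of_int (c0 + c1 + c2 + c3) > 0"
    by (rule zero_less_mult_pos2) (use conj_bounds x_gt y_gt in \<open>intro mult_pos_pos; linarith\<close>)
  thus ?thesis using lA_coord[OF c] by simp
qed

section \<open>Sums of unit multiples of the candidates\<close>

definition unit_group :: "real set" where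
  "unit_group = {x powi i * y powi j * e (x, y) powi k | i j k. True}"

definition c :: "int \<Rightarrow> real" where "c t = (x * y - 1) * (t - y')"

inductive_set pos_sums :: "real set" where
  base: "g \<in> unit_group \<Longrightarrow> s \<in> insert 1 (c ` {1..a}) \<Longrightarrow> g * s \<in> pos_sums"
| sum: "\<alpha> \<in> pos_sums \<Longrightarrow> \<beta> \<in> pos_sums \<Longrightarrow> \<alpha> + \<beta> \<in> pos_sums"

lemma unit_groupI: "x powi i * y powi j * e (x, y) powi k \<in> unit_group"
  by (auto simp: unit_group_def)

lemma xye_pos: "x > 0" "y > 0" "e (x, y) > 0"
  using x_gt y_gt e_pos by (auto simp: places_def)

lemma unit_group_mult:
  assumes "g \<in> unit_group" "h \<in> unit_group" shows "g * h \<in> unit_group"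
proof -
  obtain i j k where g: "g = x powi i * y powi j * e (x, y) powi k"
    using assms by (auto simp: unit_group_def)
  obtain i' j' k' where h: "h = x powi i' * y powi j' * e (x, y) powi k'"
    using assms by (auto simp: unit_group_def)
  have "g * h = x powi (i + i') * y powi (j + j') * e (x, y) powi (k + k')"
    using xye_pos by (simp add: g h power_int_add)
  thus ?thesis by (simp only: unit_groupI)
qed

lemma unit_group_inverse:
  assumes "g \<in> unit_group" shows "inverse g \<in> unit_group"
proof -
  obtain i j k where g: "g = x powi i * y powi j * e (x, y) powi k"
    using assms by (auto simp: unit_group_def)
  have "inverse g = x powi (- i) * y powi (- j) * e (x, y) powi (- k)"
    by (simp add: g power_int_minus)
  thus ?thesis by (simp only: unit_groupI)
qed

lemma unit_group_pos: "g \<in> unit_group \<Longrightarrow> g > 0"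
  using xye_pos by (auto simp: unit_group_def)

lemma x'_inverse: "x' = inverse x" and y'_inverse: "y' = inverse y"
  and e'_inverse: "e' (x, y) = inverse (e (x, y))"
  using x'_eq y'_eq e_e'_eq[of x y] inverse_unique by (metis, metis, force simp: places_def)

lemma unit_group_gens:
  "1 \<in> unit_group" "x \<in> unit_group" "x' \<in> unit_group" "y \<in> unit_group" "y' \<in> unit_group"
  "e (x, y) \<in> unit_group" "e' (x, y) \<in> unit_group"
proof -
  show 1: "1 \<in> unit_group" "x \<in> unit_group" "y \<in> unit_group" "e (x, y) \<in> unit_group"
    using unit_groupI[of 0 0 0] unit_groupI[of 1 0 0] unit_groupI[of 0 1 0] unit_groupI[of 0 0 1]
    by simp_all
  show "x' \<in> unit_group" "y' \<in> unit_group" "e' (x, y) \<in> unit_group"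
    unfolding x'_inverse y'_inverse e'_inverse using 1 by (simp_all add: unit_group_inverse)
qed

lemma unit_mult_pos_sums:
  assumes "\<alpha> \<in> pos_sums" "g \<in> unit_group" shows "g * \<alpha> \<in> pos_sums"
  using assms(1)
proof induction
  case (base h s)
  thus ?case using pos_sums.base[OF unit_group_mult[OF assms(2) base(1)] base(2)]
    by (simp add: mult.assoc)
qed (simp add: distrib_left pos_sums.sum)

lemma unit_in_pos_sums: "g \<in> unit_group \<Longrightarrow> g \<in> pos_sums"
  using pos_sums.base[of g 1] by simp

text \<open>\<open>pos_sums\<close> consists of nonempty sums; 0 is adjoined because
  \<open>facet_cone\<close> contains the origin.\<close>

lemma pos_sums0_add:
  "\<alpha> \<in> insert 0 pos_sums \<Longrightarrow> \<beta> \<in> insert 0 pos_sums \<Longrightarrow> \<alpha> + \<beta> \<in> insert 0 pos_sums"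
  by (auto intro: pos_sums.sum)

lemma pos_sums0_of_int:
  assumes "k \<ge> 0" "\<alpha> \<in> pos_sums" shows "of_int k * \<alpha> \<in> insert 0 pos_sums"
proof -
  have "of_nat m * \<alpha> \<in> insert 0 pos_sums" for m
  proof (induction m)
    case (Suc m)
    show ?case using pos_sums0_add[OF Suc, of \<alpha>] assms(2) by (simp add: distrib_right add.commute)
  qed simp
  from this[of "nat k"] show ?thesis using assms(1) by simp
qed

text \<open>Every generator of the cone is identified: the rows are \<open>c t\<close> and
  \<open>x * c t\<close>, and the top and bottom edges of the hexagons consist of units.\<close>

lemma facet_cone_pos_sums:
  "facet_cone a u v i j \<Longrightarrow> elt (x, y) (u, v, i, j) \<in> insert 0 pos_sums"
proof (induction rule: facet_cone.induct)
  case zero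
  show ?case by (simp add: elt_def)
next
  case (add u v i j u' v' i' j')
  have "elt (x, y) (u + u', v + v', i + i', j + j') = elt (x, y) (u, v, i, j) + elt (x, y) (u', v', i', j')"
    using elt_lin(1)[of "(x, y)" "(u, v, i, j)" "(u', v', i', j')"] by simp
  thus ?case using pos_sums0_add[OF add.IH] by simp
next
  case (P_row t)
  hence "c t \<in> pos_sums" using pos_sums.base[OF unit_group_gens(1), of "c t"] by auto
  moreover have "elt (x, y) (t, 0, 1, 0) = c t" by (simp add: elt_def c_def)
  ultimately show ?case by simp
next
  case (P_bottom \<delta>)
  have "elt (x, y) (a + 0, - 1, 1, 0) = 1" "elt (x, y) (a + 1, - 1, 1, 0) = x * y"
    using xx yy by (simp_all add: elt_def) Groebner_Basis.algebra+
  thus ?case using P_bottom by (auto simp: unit_group_gens unit_group_mult intro!: unit_in_pos_sums)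
next
  case (P_top \<delta>)
  have "elt (x, y) (0, 1, 1, 0) = x * e (x, y)" "elt (x, y) (1, 1, 1, 0) = y * e (x, y)"
    using xx yy by (simp_all add: elt_def e_def) Groebner_Basis.algebra+
  thus ?case using P_top by (auto simp: unit_group_gens unit_group_mult intro!: unit_in_pos_sums)
next
  case (Q_row t)
  have "elt (x, y) (0, t, 0, 1) = x * c t"
    by (simp add: elt_def c_def algebra_simps)
  moreover have "x * c t \<in> pos_sums"
    using pos_sums.base[OF unit_group_gens(2), of "c t"] Q_row by auto
  ultimately show ?case by simp
next
  case (Q_bottom \<delta>)
  have "elt (x, y) (- 1, a + 0, 0, 1) = x * x * e (x, y)" "elt (x, y) (- 1, a + 1, 0, 1) = x * y * e (x, y)"
    using xx yy by (simp_all add: elt_def e_def) Groebner_Basis.algebra+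
  thus ?case using Q_bottom by (auto simp: unit_group_gens unit_group_mult intro!: unit_in_pos_sums)
next
  case (Q_top \<delta>)
  have "elt (x, y) (1, 0, 0, 1) = x" "elt (x, y) (1, 1, 0, 1) = x * x * y"
    using xx yy by (simp_all add: elt_def) Groebner_Basis.algebra+
  thus ?case using Q_top by (auto simp: unit_group_gens unit_group_mult intro!: unit_in_pos_sums)
qed

theorem tp_in_pos_sums: "tp q \<Longrightarrow> elt (x, y) q \<in> pos_sums"
proof (induction "nat (min (lA q) (lB q))" arbitrary: q rule: less_induct)
  case less
  note tp = less.prems
  have pl: "(x, y) \<in> places" by (simp add: places_def)
  show ?case
  proof (rule ccontr)
    assume not: "elt (x, y) q \<notin> pos_sums"
    \<comment> \<open>If a unit brought \<open>lA\<close> or \<open>lB\<close> below the minimum,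
      the induction hypothesis would apply to the translate, and the unit could be divided out
      again.\<close>
    have step: "min (lA q) (lB q) \<le> lA (m q) \<and> min (lA q) (lB q) \<le> lB (m q)"
      if m: "unit_mult m g" "g (x, y) \<in> unit_group" for m g
    proof (rule ccontr)
      assume "\<not> ?thesis"
      hence "nat (min (lA (m q)) (lB (m q))) < nat (min (lA q) (lB q))"
        using lA_pos[OF tp] lB_pos[OF tp] by auto
      from less.hyps[OF this unit_mult_tp[OF m(1) tp]]
      have "g (x, y) * elt (x, y) q \<in> pos_sums"
        using unit_multD(2)[OF m(1) pl] by simp
      from unit_mult_pos_sums[OF this unit_group_inverse[OF m(2)]]
      have "elt (x, y) q \<in> pos_sums"
        using unit_group_pos[OF m(2)] by (simp add: field_simps)
      with not show False by blast
    qed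
    note U = unit_mults and UC = unit_mult_comp
    note G = unit_group_gens unit_group_mult
    obtain u v i j where q: "q = (u, v, i, j)" by (metis surj_pair)
    show False
    proof (cases "lB q \<le> lA q")
      case True
      have B: "lB q \<le> lB (m q)" and A: "lB q \<le> lA (m q)"
        if "unit_mult m g" "g (x, y) \<in> unit_group" for m g
        using step[OF that] True by auto
      \<comment> \<open>The first two of these yield the signs of \<open>j\<close> and
        \<open>i\<close>, the other six the mixed inequalities of \<open>facet_ineqs\<close>; the
        bounds on \<open>u\<close> or \<open>v\<close> alone come from \<open>lA\<close>.\<close>
      have B_ineqs: "lB q \<le> lB (mx q)" "lB q \<le> lB (mx' q)" "lB q \<le> lB (my q)" "lB q \<le> lB (my' q)"
        "lB q \<le> lB (mx (my q))" "lB q \<le> lB (mx (my' q))"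
        "lB q \<le> lB (mx' (my q))" "lB q \<le> lB (mx' (my' q))"
        by (rule B[OF U(1)] B[OF U(2)] B[OF U(3)] B[OF U(4)]
          B[OF UC[OF U(1) U(3)]] B[OF UC[OF U(1) U(4)]] B[OF UC[OF U(2) U(3)]] B[OF UC[OF U(2) U(4)]]; simp add: G)+
      have A_ineqs: "lB q \<le> lA q" "lB q \<le> lA (mx' (me' q))" "lB q \<le> lA (mx' q)" "lB q \<le> lA (me' q)"
        by (rule True A[OF UC[OF U(2) U(6)]] A[OF U(2)] A[OF U(6)]; simp add: G)+
      \<comment> \<open>Each excess over \<open>lB q\<close> is \<open>a - 2\<close> times a linear
        form, and \<open>a \<ge> 3\<close> permits cancelling the factor.\<close>
      have "0 \<le> (a - 2) * (v + i)" "0 \<le> (a - 2) * (u + j)"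
        "0 \<le> (a - 2) * (j + (a + 1) * i - u)" "0 \<le> (a - 2) * (i + (a + 1) * j - v)"
        using A_ineqs by (simp_all add: q me'_def algebra_simps)
      hence "0 \<le> v + i" "0 \<le> u + j" "0 \<le> j + (a + 1) * i - u" "0 \<le> i + (a + 1) * j - v"
        using a_ge by (simp_all add: zero_le_mult_iff)
      moreover have "0 \<le> (a - 2) * i" "0 \<le> (a - 2) * j"
        using B_ineqs by (simp_all add: q algebra_simps)
      hence "0 \<le> i" "0 \<le> j" using a_ge by (simp_all add: zero_le_mult_iff)
      ultimately have "facet_ineqs a u v i j"
        using B_ineqs unfolding facet_ineqs_def by (simp add: q algebra_simps)
      from facet_cone_pos_sums[OF facet_cone_if_facet_ineqs[OF _ this]] a_ge
      have "elt (x, y) q \<in> insert 0 pos_sums" by (simp add: q)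
      moreover have "elt (x, y) q > 0" using tp pl unfolding tp_def by blast
      ultimately show False using not by auto
    next
      case False
      have B: "lA q \<le> lB (m q)"
        if "unit_mult m g" "g (x, y) \<in> unit_group" for m g
        using step[OF that] False by auto
      obtain c0 c1 c2 c3 where c: "coord q = (c0, c1, c2, c3)" by (metis surj_pair)
      have c': "c0 = - u + j + (a + 1) * i" "c1 = - v - i + j" "c2 = - v - i" "c3 = u + a * v - j"
        using c by (auto simp: q)
      \<comment> \<open>The moves are chosen so that the excess of each value over
        \<open>lA q\<close> is \<open>a - 2\<close> times one coordinate in the basis
        \<open>1, x, y, x y\<close>; all four coordinates are therefore nonnegative.\<close>
      have B_ineqs: "lA q \<le> lB q" "lA q \<le> lB (me q)" "lA q \<le> lB (mx q)" "lA q \<le> lB (mx (me q))"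
        using False by - (rule order.strict_implies_order B[OF U(5)] B[OF U(1)] B[OF UC[OF U(1) U(5)]]; simp add: G)+
      have "0 \<le> (a - 2) * c2" "0 \<le> (a - 2) * c0" "0 \<le> (a - 2) * c1" "0 \<le> (a - 2) * c3"
        using B_ineqs unfolding c' by (simp_all add: q me_def algebra_simps)
      hence "0 \<le> c0" "0 \<le> c1" "0 \<le> c2" "0 \<le> c3"
        using a_ge by (simp_all add: zero_le_mult_iff)
      hence "of_int c0 * 1 + of_int c1 * x + of_int c2 * y + of_int c3 * (x * y) \<in> insert 0 pos_sums"
        by (intro pos_sums0_add pos_sums0_of_int unit_in_pos_sums) (auto simp: G)
      hence "elt (x, y) q \<in> insert 0 pos_sums"
        unfolding elt_coord[OF pl c] by simp
      moreover have "elt (x, y) q > 0" using tp pl unfolding tp_def by blast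
      ultimately show False using not by auto
    qed
  qed
qed

end

section \<open>The biquadratic field\<close>

locale biquadratic = positive_cone +
  fixes n p q :: int
  assumes n_ge: "n \<ge> 2" and a_def: "a = 4 * n"
    and p_def: "p = (2 * n - 1) * (2 * n + 1)" and q_def: "q = (4 * n - 1) * (4 * n + 3)"
    and coprime_pq: "coprime p q" and sqf_p: "squarefree p" and sqf_q: "squarefree q"
    and x_def: "x = 2 * n + sqrt (of_int p)" and y_def: "y = (4 * n + 1 + sqrt (of_int q)) / 2"
begin

abbreviation "sp \<equiv> sqrt (of_int p)"
abbreviation "sq \<equiv> sqrt (of_int q)"

definition K :: "real set" where "K = quad_ext (quad_field p) sq"

lemma pq_bounds: "p > 1" "q > 1" "p * q > 1"
proof -
  have "3 * 5 \<le> (2 * n - 1) * (2 * n + 1)" using n_ge by (intro mult_mono) auto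
  thus p: "p > 1" by (simp add: p_def)
  have "7 * 11 \<le> (4 * n - 1) * (4 * n + 3)" using n_ge by (intro mult_mono) auto
  thus q: "q > 1" by (simp add: q_def)
  show "p * q > 1" using p q less_1_mult by blast
qed

lemma pq_mod: "p mod 4 = 3" "odd q" "(p * q) mod 4 = 3"
proof -
  define k l where "k = n * n - 1" and "l = 4 * (n * n) + 2 * n - 1"
  have p: "p = 3 + 4 * k" and q: "q = 1 + 4 * l"
    by (simp_all add: p_def q_def k_def l_def algebra_simps)
  show "p mod 4 = 3" unfolding p by simp
  show "odd q" unfolding q by simp
  have "q mod 4 = 1" unfolding q by simp
  thus "(p * q) mod 4 = 3" using \<open>p mod 4 = 3\<close> mod_mult_eq[of p 4 q] by simp
qed

lemma sqf_pq: "squarefree (p * q)"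
  using coprime_pq sqf_p sqf_q by (simp add: squarefree_mult_coprime)

lemma sp_sq: "sp * sq = sqrt (of_int (p * q))" "sp * sp = of_int p" "sq * sq = of_int q"
  using pq_bounds by (simp_all add: real_sqrt_mult)

lemma subfields: "is_subfield (quad_field p)" "is_subfield K"
proof -
  show F: "is_subfield (quad_field p)" using quad_field pq_bounds by simp
  have "sq * sq \<in> quad_field p" unfolding sp_sq by (rule is_subfield_of_int[OF F])
  thus "is_subfield K" unfolding K_def by (rule is_subfield_quad_ext[OF F])
qed

text \<open>Squaring \<open>sq = b + c * sp\<close> makes \<open>2 * b * c * sp\<close> rational, so
  \<open>b\<close> or \<open>c\<close> is 0, and then \<open>sp * sq\<close> or \<open>sq\<close>
  would be rational.\<close>

lemma sq_notin: "sq \<notin> quad_field p"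
proof
  assume "sq \<in> quad_field p"
  then obtain b c where bc: "b \<in> \<rat>" "c \<in> \<rat>" "sq = b + c * sp" by (rule quad_extE)
  have irr: "sp \<notin> \<rat>" "sq \<notin> \<rat>" "sqrt (of_int (p * q)) \<notin> \<rat>"
    using sqrt_squarefree_irrational pq_bounds sqf_p sqf_q sqf_pq by blast+
  have "sq * sq = (b * b + c * c * (sp * sp)) + 2 * b * c * sp"
    unfolding bc(3) by (simp add: algebra_simps)
  hence "2 * b * c * sp = of_int q - b * b - c * c * of_int p"
    unfolding sp_sq by linarith
  hence eq: "(2 * b * c) * sp \<in> \<rat>" using bc(1,2) by simp
  have "2 * b * c = 0"
  proof (rule ccontr)
    assume nz: "2 * b * c \<noteq> 0"
    have "(2 * b * c) * sp / (2 * b * c) \<in> \<rat>" by (rule Rats_divide[OF eq]) (use bc in simp)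
    thus False using irr nz by simp
  qed
  hence "b = 0 \<or> c = 0" by simp
  thus False
  proof
    assume "c = 0"
    thus False using bc irr by simp
  next
    assume "b = 0"
    hence "sp * sq = c * (sp * sp)" unfolding bc(3) by simp
    hence "sqrt (of_int (p * q)) = c * of_int p" by (simp only: sp_sq)
    thus False using irr(3) bc(2) by simp
  qed
qed

lemma sp_notin: "sp \<notin> \<rat>"
  using sqrt_squarefree_irrational pq_bounds sqf_p by blast

lemma K_embedding:
  assumes "s = sp \<or> s = - sp" "t = sq \<or> t = - sq"
  shows "\<exists>\<sigma>. real_embedding K \<sigma> \<and> (\<forall>b\<in>\<rat>. \<forall>c\<in>\<rat>. \<forall>d\<in>\<rat>. \<forall>f\<in>\<rat>.
    \<sigma> ((b + c * sp) + (d + f * sp) * sq) = (b + c * s) + (d + f * s) * t)"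
proof -
  have st: "s * s = of_int p" "t * t = of_int q" using assms sp_sq(2,3) by auto
  obtain \<rho> where \<rho>: "real_embedding (quad_field p) \<rho>" "\<And>x. x \<in> \<rat> \<Longrightarrow> \<rho> x = x" "\<rho> sp = s"
    by (rule real_embedding_quad_ext[OF is_subfield_Rats real_embedding_id sp_notin, of s])
       (simp_all only: sp_sq st Rats_of_int)
  have "t * t = \<rho> (sq * sq)" by (simp only: sp_sq st \<rho>(2) Rats_of_int)
  moreover have "sq * sq \<in> quad_field p" unfolding sp_sq by (rule is_subfield_of_int[OF subfields(1)])
  ultimately obtain \<sigma> where \<sigma>: "real_embedding K \<sigma>"
    "\<And>x. x \<in> quad_field p \<Longrightarrow> \<sigma> x = \<rho> x" "\<sigma> sq = t"
    using real_embedding_quad_ext[OF subfields(1) \<rho>(1) sq_notin] unfolding K_def by metis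
  have sub: "\<rat> \<subseteq> quad_field p" "sp \<in> quad_field p" "quad_field p \<subseteq> K" "sq \<in> K"
    using subset_quad_ext[OF is_subfield_Rats] subset_quad_ext[OF subfields(1)]
    by (auto simp: K_def)
  have \<rho>F: "\<rho> (b + c * sp) = b + c * s" if "b \<in> \<rat>" "c \<in> \<rat>" for b c
    using that sub \<rho> by (simp add: real_embeddingD[OF \<rho>(1) subfields(1)] is_subfieldD[OF subfields(1)] subset_iff)
  have "\<sigma> ((b + c * sp) + (d + f * sp) * sq) = (b + c * s) + (d + f * s) * t"
    if "b \<in> \<rat>" "c \<in> \<rat>" "d \<in> \<rat>" "f \<in> \<rat>" for b c d f
  proof -
    have F: "b + c * sp \<in> quad_field p" "d + f * sp \<in> quad_field p"
      using that by (simp_all add: quad_extI)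
    hence "b + c * sp \<in> K" "d + f * sp \<in> K" using sub by blast+
    thus ?thesis
      using sub(4) F by (simp add: real_embeddingD[OF \<sigma>(1) subfields(2)] is_subfieldD[OF subfields(2)]
        \<sigma>(2,3) \<rho>F that)
  qed
  thus ?thesis using \<sigma>(1) by blast
qed

lemma xy_K: "x \<in> K" "y \<in> K"
proof -
  have "2 * n + 1 * sp \<in> quad_field p" by (rule quad_extI) simp_all
  hence "(2 * n + 1 * sp) + 0 * sq \<in> K"
    unfolding K_def using is_subfieldD(1)[OF subfields(1)] by (rule quad_extI)
  thus "x \<in> K" by (simp add: x_def)
  have "b \<in> quad_field p" if "b \<in> \<rat>" for b
    using that subset_quad_ext[OF is_subfield_Rats] by blast
  hence "(4 * n + 1) / 2 + (1 / 2) * sq \<in> K"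
    unfolding K_def by (intro quad_extI) simp_all
  thus "y \<in> K" by (simp add: y_def field_simps)
qed

lemma xy_int: "algebraic_int x" "algebraic_int y"
  by (rule algebraic_int_quadratic[of _ a 1], use xx in simp)
     (rule algebraic_int_quadratic[of _ "a + 1" 1], use yy in simp)

section \<open>The integral basis and the embeddings\<close>

definition comb :: "int \<Rightarrow> int \<Rightarrow> int \<Rightarrow> int \<Rightarrow> real" where
  "comb c0 c1 c2 c3 = of_int c0 + of_int c1 * x + of_int c2 * y + of_int c3 * (x * y)"

lemma comb_in_ring: "comb c0 c1 c2 c3 \<in> ring_of_integers K"
  unfolding comb_def ring_of_integers_def
  by (simp add: xy_K xy_int is_subfieldD[OF subfields(2)] is_subfield_of_int[OF subfields(2)]
      algebraic_int_add algebraic_int_mult algebraic_int_of_int)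

text \<open>The relative traces to the three quadratic subfields make all doubled coordinates
  integers. Subtracting an integral \<open>w\<close> with the same \<open>sq\<close>-part leaves an
  integer of \<open>quad_field p\<close>, where \<open>p mod 4 = 3\<close> rules out half-integral
  coefficients.\<close>

lemma ring_of_integers_comb:
  assumes "z \<in> ring_of_integers K"
  obtains c0 c1 c2 c3 where "z = comb c0 c1 c2 c3"
proof -
  have zK: "z \<in> K" and zint: "algebraic_int z" using assms by (auto simp: ring_of_integers_def)
  obtain F G where FG: "F \<in> quad_field p" "G \<in> quad_field p" "z = F + G * sq"
    using zK unfolding K_def by (rule quad_extE)
  obtain b c where bc: "b \<in> \<rat>" "c \<in> \<rat>" "F = b + c * sp" using FG(1) by (rule quad_extE)
  obtain d f where df: "d \<in> \<rat>" "f \<in> \<rat>" "G = d + f * sp" using FG(2) by (rule quad_extE)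
  have z: "z = (b + c * sp) + (d + f * sp) * sq" by (simp only: FG bc df)
  have trace: "algebraic_int (z + ((b + c * s) + (d + f * s) * t))"
    if st: "s = sp \<or> s = - sp" "t = sq \<or> t = - sq" for s t
  proof -
    obtain \<sigma> where "real_embedding K \<sigma>" "\<sigma> z = (b + c * s) + (d + f * s) * t"
      using K_embedding[OF st] bc df z by blast
    thus ?thesis
      using algebraic_int_add[OF zint] algebraic_int_real_embedding[OF _ subfields(2) zK zint] by metis
  qed
  have "algebraic_int (2 * b + (2 * c) * sp)"
    using trace[of sp "- sq"] by (simp add: z algebra_simps)
  hence "2 * b \<in> \<int>" "2 * c \<in> \<int>"
    using quad_int_3_mod_4[OF sqf_p pq_bounds(1) pq_mod(1), of "2 * b" "2 * c"] bc by simp_all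
  moreover have "algebraic_int (2 * b + (2 * d) * sq)"
    using trace[of "- sp" sq] by (simp add: z algebra_simps)
  hence "2 * d \<in> \<int>"
    using quad_int_1_mod_4[OF sqf_q pq_bounds(2) pq_mod(2) \<open>2 * b \<in> \<int>\<close>, of "2 * d"] df by simp
  moreover have "algebraic_int (2 * b + (2 * f) * (sp * sq))"
    using trace[of "- sp" "- sq"] by (simp add: z algebra_simps)
  hence "2 * f \<in> \<int>"
    unfolding sp_sq
    using quad_int_3_mod_4[OF sqf_pq pq_bounds(3) pq_mod(3), of "2 * b" "2 * f"] bc df by simp
  ultimately obtain B C D F where BC: "2 * b = of_int B" "2 * c = of_int C"
    "2 * d = of_int D" "2 * f = of_int F"
    by (auto elim!: Ints_cases)
  \<comment> \<open>As \<open>x - 2 * n = sp\<close> and \<open>y - 2 * n = (1 + sq) / 2\<close>,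
    this is \<open>(D + F * sp) * (1 + sq) / 2\<close>, whose \<open>sq\<close>-part is
    \<open>d + f * sp\<close>.\<close>
  define w where "w = comb (- 2 * n * D + 4 * n * n * F) (- 2 * n * F) (D - 2 * n * F) F"
  have w: "w = (of_int D + of_int F * (x - 2 * n)) * (y - 2 * n)"
    by (simp add: w_def comb_def algebra_simps)
  have zw: "z - w = (of_int (B - D) / 2) + (of_int (C - F) / 2) * sp"
  proof -
    have "w = (of_int D + of_int F * sp) * ((1 + sq) / 2)"
      by (simp add: w x_def y_def field_simps)
    also have "\<dots> = (2 * d + (2 * f) * sp) * ((1 + sq) / 2)" by (simp only: BC)
    finally have w': "w = d + f * sp + (d + f * sp) * sq" by (simp add: field_simps)
    have half: "of_int (B - D) / 2 = b - d" "of_int (C - F) / 2 = c - f"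
      by (simp_all flip: BC add: field_simps)
    show ?thesis unfolding half by (simp add: z w' algebra_simps)
  qed
  have "algebraic_int (z - w)"
    using zint comb_in_ring unfolding w_def ring_of_integers_def by (intro algebraic_int_diff) auto
  hence int: "algebraic_int (of_int (B - D) / 2 + of_int (C - F) / 2 * sp)" unfolding zw .
  have rat: "of_int (B - D) / 2 \<in> (\<rat> :: real set)" "of_int (C - F) / 2 \<in> (\<rat> :: real set)" by simp_all
  have "of_int (B - D) / 2 \<in> (\<int> :: real set)" "of_int (C - F) / 2 \<in> (\<int> :: real set)"
    by (rule quad_int_3_mod_4[OF sqf_p pq_bounds(1) pq_mod(1) rat int])+
  then obtain m k where mk: "of_int (B - D) / 2 = (of_int m :: real)" "of_int (C - F) / 2 = (of_int k :: real)"
    by (auto elim!: Ints_cases)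
  have "z = w + (of_int m + of_int k * (x - 2 * n))"
    using zw unfolding mk by (simp add: x_def)
  hence "z = comb (- 2 * n * D + 4 * n * n * F + m - 2 * n * k) (- 2 * n * F + k) (D - 2 * n * F) F"
    by (simp add: w_def comb_def algebra_simps)
  thus ?thesis using that by blast
qed

text \<open>Independence follows the tower: \<open>x\<close> is irrational and \<open>y\<close> lies
  outside \<open>quad_field p\<close>.\<close>

lemma comb_eq_0:
  assumes "comb c0 c1 c2 c3 = 0"
  shows "c0 = 0 \<and> c1 = 0 \<and> c2 = 0 \<and> c3 = 0"
proof -
  have xF: "x \<in> quad_field p"
    using quad_extI[of "2 * n" \<rat> 1 sp] by (simp add: x_def)
  have xQ: "x \<notin> \<rat>"
  proof
    assume "x \<in> \<rat>"
    hence "x - 2 * n \<in> \<rat>" by simp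
    thus False using sp_notin by (simp add: x_def)
  qed
  have yF: "y \<notin> quad_field p"
  proof
    assume "y \<in> quad_field p"
    hence "(y + y) - of_int (4 * n + 1) \<in> quad_field p"
      using is_subfieldD(3,4)[OF subfields(1)] is_subfield_of_int[OF subfields(1)] by metis
    moreover have "(y + y) - of_int (4 * n + 1) = sq" by (simp add: y_def)
    ultimately show False using sq_notin by simp
  qed
  have F: "of_int k + of_int l * x \<in> quad_field p" for k l :: int
    using xF by (simp add: is_subfieldD[OF subfields(1)] is_subfield_of_int[OF subfields(1)])
  have "(of_int c0 + of_int c1 * x) + (of_int c2 + of_int c3 * x) * y = 0 + 0 * y"
    using assms by (simp add: comb_def algebra_simps)
  hence "of_int c0 + of_int c1 * x = 0 \<and> of_int c2 + of_int c3 * x = 0"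
    using quad_ext_coords_unique[OF subfields(1) yF F F] is_subfieldD(1)[OF subfields(1)] by blast
  moreover have "k = 0 \<and> l = 0" if "of_int k + of_int l * x = 0" for k l :: int
    using quad_ext_coords_unique[OF is_subfield_Rats xQ, of "of_int k" "of_int l" 0 0] that by simp
  ultimately show ?thesis by blast
qed

lemma embedding_place:
  assumes \<sigma>: "real_embedding K \<sigma>"
  shows "(\<sigma> x, \<sigma> y) \<in> places" "\<sigma> (comb c0 c1 c2 c3) = c0 + c1 * \<sigma> x + c2 * \<sigma> y + c3 * (\<sigma> x * \<sigma> y)"
proof -
  note \<sigma>' = real_embeddingD[OF \<sigma> subfields(2)]
  note K' = is_subfieldD[OF subfields(2)] is_subfield_of_int[OF subfields(2)]
  have "\<sigma> x * \<sigma> x = \<sigma> (of_int a * x - 1)" using xy_K xx \<sigma>'(4)[of x x] by simp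
  also have "\<dots> = a * \<sigma> x - 1" using xy_K K' by (simp add: \<sigma>')
  finally have "(\<sigma> x - x) * (\<sigma> x - x') = 0" using x'_eq by (simp add: algebra_simps)
  moreover have "\<sigma> y * \<sigma> y = \<sigma> (of_int (a + 1) * y - 1)" using xy_K yy \<sigma>'(4)[of y y] by simp
  hence "\<sigma> y * \<sigma> y = of_int (a + 1) * \<sigma> y - 1" using xy_K K'(1,2,3,4,5) K'(9)[of "a + 1"] \<sigma>'(2,4,6,7) by metis
  hence "(\<sigma> y - y) * (\<sigma> y - y') = 0" using y'_eq by (simp add: algebra_simps)
  ultimately show "(\<sigma> x, \<sigma> y) \<in> places" by (auto simp: places_def)
  show "\<sigma> (comb c0 c1 c2 c3) = c0 + c1 * \<sigma> x + c2 * \<sigma> y + c3 * (\<sigma> x * \<sigma> y)"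
    unfolding comb_def using xy_K K' by (simp add: \<sigma>')
qed

lemma place_embedding:
  assumes "(X, Y) \<in> places"
  obtains \<sigma> where "real_embedding K \<sigma>" "\<sigma> x = X" "\<sigma> y = Y"
proof -
  define s where "s = X - 2 * n"
  define t where "t = 2 * Y - (4 * n + 1)"
  have "X = x \<or> X = x'" "Y = y \<or> Y = y'" using assms by (auto simp: places_def)
  hence "s = sp \<or> s = - sp" "t = sq \<or> t = - sq"
    by (auto simp: s_def t_def x_def y_def a_def field_simps)
  then obtain \<sigma> where \<sigma>: "real_embedding K \<sigma>" "\<And>b c d f. b \<in> \<rat> \<Longrightarrow> c \<in> \<rat> \<Longrightarrow> d \<in> \<rat> \<Longrightarrow> f \<in> \<rat> \<Longrightarrow>
    \<sigma> ((b + c * sp) + (d + f * sp) * sq) = (b + c * s) + (d + f * s) * t"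
    using K_embedding[of s t] by blast
  have "\<sigma> x = X" using \<sigma>(2)[of "2 * n" 1 0 0] by (simp add: x_def s_def)
  moreover have "\<sigma> y = Y" using \<sigma>(2)[of "(4 * n + 1) / 2" 0 "1 / 2" 0]
    by (simp add: y_def t_def field_simps)
  ultimately show ?thesis using that \<sigma>(1) by blast
qed

end

section \<open>Classification of the indecomposables\<close>

text \<open>At \<open>X = x\<close>, \<open>Y = y\<close>, \<open>N = n\<close> the right sides are
  twice \<open>c (2 * n) * x'\<close> and \<open>c (2 * n + 1) * y'\<close>, since
  \<open>w y' = x - y'\<close>. This explains the halves in the theorem.\<close>

lemma conj_identity:
  fixes X X' Y Y' N :: real
  assumes "X * X' = 1" "Y * Y' = 1" "X + X' = 4 * N" "Y + Y' = 4 * N + 1"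
  shows "X' + (X * Y + X' * Y' - 2) = 2 * ((X * Y - 1) * (2 * N - Y') * X')"
    and "X + (X * Y + X' * Y' - 2) = 2 * ((2 * N + 1 - Y') * (X - Y'))"
  using assms by Groebner_Basis.algebra+

context biquadratic
begin

lemma ring_of_integers_closed:
  assumes "z \<in> ring_of_integers K" "w \<in> ring_of_integers K"
  shows "z * w \<in> ring_of_integers K"
  using assms is_subfieldD(5)[OF subfields(2)] algebraic_int_mult by (auto simp: ring_of_integers_def)

text \<open>The change of coordinates is unimodular. The witness is its inverse, found by solving
  first for \<open>i = c0 + c3 + a * c2\<close> and \<open>j = c1 - c2\<close>.\<close>

lemma coord_surj: "\<exists>Q. coord Q = (c0, c1, c2, c3)"
  by (rule exI[of _ "(- c0 + (c1 - c2) + (a + 1) * (c0 + c3 + a * c2), - c2 - (c0 + c3 + a * c2),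
        c0 + c3 + a * c2, c1 - c2)"]) (simp add: algebra_simps)

lemma coord_inj:
  assumes "coord Q = coord R" shows "Q = R"
proof -
  have inv: "Q = (- c0 + (c1 - c2) + (a + 1) * (c0 + c3 + a * c2), - c2 - (c0 + c3 + a * c2),
        c0 + c3 + a * c2, c1 - c2)" if Q: "coord Q = (c0, c1, c2, c3)" for Q c0 c1 c2 c3
  proof -
    obtain u v i j where uvij: "Q = (u, v, i, j)" by (metis surj_pair)
    have c: "c0 = - u + j + (a + 1) * i" "c1 = - v - i + j" "c2 = - v - i" "c3 = u + a * v - j"
      using Q by (auto simp: uvij)
    show ?thesis unfolding c uvij by (simp add: algebra_simps)
  qed
  obtain c0 c1 c2 c3 where c: "coord Q = (c0, c1, c2, c3)" by (metis surj_pair)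
  show ?thesis using inv[OF c] inv[of R c0 c1 c2 c3] assms c by simp
qed

lemma xy_place: "(x, y) \<in> places"
  by (simp add: places_def)

lemma elt_comb: "coord Q = (c0, c1, c2, c3) \<Longrightarrow> elt (x, y) Q = comb c0 c1 c2 c3"
  using elt_coord[OF xy_place] by (simp add: comb_def)

lemma elt_in_ring: "elt (x, y) Q \<in> ring_of_integers K"
  by (cases "coord Q") (simp add: elt_comb comb_in_ring)

lemma ring_of_integers_elt: "z \<in> ring_of_integers K \<Longrightarrow> \<exists>Q. z = elt (x, y) Q"
  by (metis ring_of_integers_comb coord_surj elt_comb)

lemma elt_inj:
  assumes "elt (x, y) Q = elt (x, y) R" shows "Q = R"
proof -
  obtain c0 c1 c2 c3 where c: "coord Q = (c0, c1, c2, c3)" by (metis surj_pair)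
  obtain d0 d1 d2 d3 where d: "coord R = (d0, d1, d2, d3)" by (metis surj_pair)
  have "comb (c0 - d0) (c1 - d1) (c2 - d2) (c3 - d3) = 0"
    using assms by (simp add: elt_comb[OF c] elt_comb[OF d]) (simp add: comb_def algebra_simps)
  from comb_eq_0[OF this] have "coord Q = coord R" by (simp add: c d)
  thus ?thesis by (rule coord_inj)
qed

lemma embedding_elt:
  assumes "real_embedding K \<sigma>" shows "\<sigma> (elt (x, y) Q) = elt (\<sigma> x, \<sigma> y) Q"
proof -
  obtain c0 c1 c2 c3 where c: "coord Q = (c0, c1, c2, c3)" by (metis surj_pair)
  show ?thesis
    using embedding_place[OF assms] elt_coord[OF _ c] by (simp add: elt_comb[OF c])
qed

text \<open>Real embeddings of \<open>K\<close> and places correspond, which turns total positivity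
  into the coordinate condition \<open>tp\<close>.\<close>

lemma tot_pos_integers_eq: "tot_pos_integers K = elt (x, y) ` {Q. tp Q}"
proof (intro equalityI subsetI)
  fix z assume z: "z \<in> tot_pos_integers K"
  then obtain Q where Q: "z = elt (x, y) Q"
    using ring_of_integers_elt unfolding tot_pos_integers_def by blast
  have "elt P Q > 0" if "P \<in> places" for P
  proof -
    obtain X Y where P: "P = (X, Y)" by fastforce
    obtain \<sigma> where \<sigma>: "real_embedding K \<sigma>" "\<sigma> x = X" "\<sigma> y = Y"
      using place_embedding \<open>P \<in> places\<close> unfolding P by blast
    have "\<sigma> z > 0" using z \<sigma>(1) by (simp add: tot_pos_integers_def)
    thus ?thesis using embedding_elt[OF \<sigma>(1)] by (simp add: Q P \<sigma>)
  qed
  thus "z \<in> elt (x, y) ` {Q. tp Q}" using Q by (auto simp: tp_def)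
next
  fix z assume "z \<in> elt (x, y) ` {Q. tp Q}"
  then obtain Q where Q: "z = elt (x, y) Q" "tp Q" by blast
  have "\<sigma> z > 0" if "real_embedding K \<sigma>" for \<sigma>
    using embedding_elt[OF that] embedding_place(1)[OF that] Q by (simp add: tp_def)
  thus "z \<in> tot_pos_integers K" using elt_in_ring Q by (simp add: tot_pos_integers_def)
qed

section \<open>Totally positive units\<close>

lemma tot_pos_integers_mult:
  assumes "z \<in> tot_pos_integers K" "w \<in> tot_pos_integers K"
  shows "z * w \<in> tot_pos_integers K"
proof -
  have "\<sigma> (z * w) > 0" if "real_embedding K \<sigma>" for \<sigma>
    using assms that real_embeddingD(4)[OF that subfields(2), of z w]
    by (simp add: tot_pos_integers_def ring_of_integers_def)
  thus ?thesis
    using assms ring_of_integers_closed by (simp add: tot_pos_integers_def)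
qed

lemma tot_pos_integers_add:
  assumes "z \<in> tot_pos_integers K" "w \<in> tot_pos_integers K"
  shows "z + w \<in> tot_pos_integers K"
proof -
  obtain Q R where "z = elt (x, y) Q" "tp Q" "w = elt (x, y) R" "tp R"
    using assms unfolding tot_pos_integers_eq by blast
  moreover from this have "tp (qadd Q R)" unfolding tp_def by (metis elt_lin(1) add_pos_pos)
  ultimately have "z + w = elt (x, y) (qadd Q R)" "tp (qadd Q R)" by (simp_all only: elt_lin)
  thus ?thesis unfolding tot_pos_integers_eq by blast
qed

lemma tot_pos_unitsI:
  assumes "u \<in> tot_pos_integers K" "v \<in> ring_of_integers K" "u * v = 1"
  shows "u \<in> tot_pos_units K"
  using assms by (auto simp: tot_pos_units_def integer_units_def tot_pos_integers_def)

lemma tot_pos_units_inverse: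
  assumes u: "u \<in> tot_pos_units K" shows "inverse u \<in> tot_pos_units K"
proof -
  obtain v where v: "v \<in> ring_of_integers K" "u * v = 1"
    using u by (auto simp: tot_pos_units_def integer_units_def)
  have uK: "u \<in> tot_pos_integers K" "u \<in> ring_of_integers K" "u \<in> K" and vK: "v \<in> K"
    using u v by (auto simp: tot_pos_units_def tot_pos_integers_def ring_of_integers_def)
  have "\<sigma> v > 0" if \<sigma>: "real_embedding K \<sigma>" for \<sigma>
  proof -
    have "0 < \<sigma> u * \<sigma> v"
      using real_embeddingD(2)[OF \<sigma> subfields(2)] real_embeddingD(4)[OF \<sigma> subfields(2) uK(3) vK] v(2)
      by simp
    moreover have "\<sigma> u > 0" using uK(1) \<sigma> by (simp add: tot_pos_integers_def)
    ultimately show ?thesis by (rule zero_less_mult_pos)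
  qed
  hence "v \<in> tot_pos_integers K" using v(1) by (simp add: tot_pos_integers_def)
  hence "v \<in> tot_pos_units K" using tot_pos_unitsI[of v u] uK(2) v(2) by (simp add: mult.commute)
  moreover have "inverse u = v" using v(2) by (rule inverse_unique)
  ultimately show ?thesis by simp
qed

lemma tot_pos_units_mult:
  assumes "u \<in> tot_pos_units K" "v \<in> tot_pos_units K" shows "u * v \<in> tot_pos_units K"
proof -
  obtain u' v' where u': "u' \<in> ring_of_integers K" "u * u' = 1" and v': "v' \<in> ring_of_integers K" "v * v' = 1"
    using assms by (auto simp: tot_pos_units_def integer_units_def)
  have "(u * v) * (u' * v') = (u * u') * (v * v')" by (simp only: mult_ac)
  hence "(u * v) * (u' * v') = 1" using u' v' by simp
  thus ?thesis
    using assms ring_of_integers_closed[OF u'(1) v'(1)]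
    by (intro tot_pos_unitsI[of _ "u' * v'"] tot_pos_integers_mult) (simp_all add: tot_pos_units_def)
qed

lemma elt_one: "(X, Y) \<in> places \<Longrightarrow> elt (X, Y) (a, - 1, 1, 0) = 1"
  using elt_coord[of X Y "(a, - 1, 1, 0)" 1 0 0 0] by simp

lemma tp_one: "tp (a, - 1, 1, 0)"
  by (auto simp: tp_def elt_one)

lemma one_tot_pos_unit: "1 \<in> tot_pos_units K"
proof -
  have "1 \<in> tot_pos_integers K"
    unfolding tot_pos_integers_eq using tp_one elt_one[OF xy_place] by force
  thus ?thesis using tot_pos_unitsI[of 1 1] by (simp add: tot_pos_integers_def)
qed

text \<open>Applying \<open>m\<close> to the vector of 1 exhibits \<open>g (x, y)\<close> as a
  totally positive integer, and \<open>m'\<close> exhibits its inverse as an integer.\<close>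

lemma unit_mult_tot_pos_unit:
  assumes "unit_mult m g" "unit_mult m' g'" "g (x, y) * g' (x, y) = 1"
  shows "g (x, y) \<in> tot_pos_units K"
proof (rule tot_pos_unitsI)
  have "g (x, y) = elt (x, y) (m (a, - 1, 1, 0))" "g' (x, y) = elt (x, y) (m' (a, - 1, 1, 0))"
    using unit_multD(2)[OF assms(1) xy_place] unit_multD(2)[OF assms(2) xy_place] elt_one[OF xy_place]
    by simp_all
  thus "g (x, y) \<in> tot_pos_integers K" "g' (x, y) \<in> ring_of_integers K"
    using unit_mult_tp[OF assms(1) tp_one] elt_in_ring unfolding tot_pos_integers_eq by auto
qed (rule assms(3))

lemma gens_tot_pos_units: "x \<in> tot_pos_units K" "y \<in> tot_pos_units K" "e (x, y) \<in> tot_pos_units K"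
  using unit_mult_tot_pos_unit[OF unit_mults(1,2)] unit_mult_tot_pos_unit[OF unit_mults(3,4)]
    unit_mult_tot_pos_unit[OF unit_mults(5,6)] x'_eq y'_eq e_e'_eq[OF xy_place]
  by simp_all

lemma tot_pos_units_power_int: "u \<in> tot_pos_units K \<Longrightarrow> u powi i \<in> tot_pos_units K"
proof -
  assume u: "u \<in> tot_pos_units K"
  have pow: "v ^ k \<in> tot_pos_units K" if "v \<in> tot_pos_units K" for v k
    using that by (induction k) (simp_all add: one_tot_pos_unit tot_pos_units_mult)
  show "u powi i \<in> tot_pos_units K"
    using pow[OF u] pow[OF tot_pos_units_inverse[OF u]] by (simp add: power_int_def)
qed

lemma unit_group_tot_pos_units: "unit_group \<subseteq> tot_pos_units K"
  using gens_tot_pos_units tot_pos_units_power_int tot_pos_units_mult by (auto simp: unit_group_def)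

section \<open>The indecomposables and the unit group\<close>

lemma c_elt: "c t = elt (x, y) (t, 0, 1, 0)"
  by (simp add: elt_def c_def)

text \<open>Since \<open>y' < 1\<close> and \<open>a < y\<close>, \<open>t\<close> lies strictly
  between \<open>y'\<close> and \<open>y\<close>, so both factors of \<open>c t\<close> have the
  same sign at every place.\<close>

lemma tp_c:
  assumes "1 \<le> t" "t \<le> a" shows "tp (t, 0, 1, 0)"
proof -
  have t: "1 \<le> (of_int t :: real)" "of_int t \<le> (of_int a :: real)" using assms by simp_all
  hence "t - y' > 0" "t - y < 0" using conj_bounds by linarith+
  thus ?thesis
    using w_sign by (auto simp: tp_def places_def elt_def zero_less_mult_iff)
qed

lemma l_qadd: "lA (qadd Q R) = lA Q + lA R" "lB (qadd Q R) = lB Q + lB R"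
  by (cases Q; cases R; simp add: algebra_simps)+

text \<open>Both functionals are additive and at least 1 on totally positive integers, so the value
  1 cannot be split.\<close>

lemma indecomposableI:
  assumes "tp Q" "lA Q = 1 \<or> lB Q = 1"
  shows "elt (x, y) Q \<in> indecomposables K"
proof -
  have False if \<beta>\<gamma>: "\<beta> \<in> tot_pos_integers K" "\<gamma> \<in> tot_pos_integers K" "elt (x, y) Q = \<beta> + \<gamma>" for \<beta> \<gamma>
  proof -
    obtain R s where rs: "tp R" "tp s" "\<beta> = elt (x, y) R" "\<gamma> = elt (x, y) s"
      using \<beta>\<gamma> unfolding tot_pos_integers_eq by blast
    have "elt (x, y) Q = elt (x, y) (qadd R s)" using \<beta>\<gamma>(3) by (simp only: rs elt_lin)
    hence "Q = qadd R s" by (rule elt_inj)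
    hence "lA Q = lA R + lA s" "lB Q = lB R + lB s" by (simp_all only: l_qadd)
    thus False using assms(2) lA_pos[OF rs(1)] lA_pos[OF rs(2)] lB_pos[OF rs(1)] lB_pos[OF rs(2)]
      by linarith
  qed
  thus ?thesis using assms(1) by (auto simp: indecomposables_def tot_pos_integers_eq)
qed

lemma one_indecomposable: "1 \<in> indecomposables K"
  using indecomposableI[OF tp_one] elt_one[OF xy_place] by simp

lemma c_indecomposable: "1 \<le> t \<Longrightarrow> t \<le> a \<Longrightarrow> c t \<in> indecomposables K"
  unfolding c_elt by (intro indecomposableI tp_c) auto

lemma indecomposables_unit_mult:
  assumes "\<alpha> \<in> indecomposables K" "u \<in> tot_pos_units K"
  shows "u * \<alpha> \<in> indecomposables K"
proof -
  have u: "u \<in> tot_pos_integers K" "inverse u \<in> tot_pos_integers K"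
    using assms(2) tot_pos_units_inverse by (auto simp: tot_pos_units_def)
  have u0: "u \<noteq> 0" using assms(2) by (auto simp: tot_pos_units_def integer_units_def)
  have False if "\<beta> \<in> tot_pos_integers K" "\<gamma> \<in> tot_pos_integers K" "u * \<alpha> = \<beta> + \<gamma>" for \<beta> \<gamma>
  proof -
    have "\<alpha> = inverse u * (u * \<alpha>)" using u0 by simp
    also have "\<dots> = inverse u * \<beta> + inverse u * \<gamma>" by (simp only: that distrib_left)
    finally show False
      using assms(1) tot_pos_integers_mult[OF u(2)] that(1,2) by (auto simp: indecomposables_def)
  qed
  moreover have "u * \<alpha> \<in> tot_pos_integers K"
    using assms(1) u by (intro tot_pos_integers_mult) (auto simp: indecomposables_def)
  ultimately show ?thesis by (auto simp: indecomposables_def)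
qed

lemma pos_sums_tot_pos: "\<alpha> \<in> pos_sums \<Longrightarrow> \<alpha> \<in> tot_pos_integers K"
proof (induction rule: pos_sums.induct)
  case (base g s)
  have "s \<in> indecomposables K" using base(2) one_indecomposable c_indecomposable by auto
  from indecomposables_unit_mult[OF this] base(1) unit_group_tot_pos_units
  show ?case by (auto simp: indecomposables_def)
qed (rule tot_pos_integers_add)

lemma indecomposable_cases:
  assumes "\<alpha> \<in> indecomposables K"
  obtains g s where "g \<in> unit_group" "s \<in> insert 1 (c ` {1..a})" "\<alpha> = g * s"
proof -
  have "\<alpha> \<in> tot_pos_integers K" using assms by (simp add: indecomposables_def)
  hence "\<alpha> \<in> pos_sums" using tp_in_pos_sums unfolding tot_pos_integers_eq by blast
  thus ?thesis
  proof cases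
    case (base g s)
    thus ?thesis using that by blast
  next
    case (sum \<beta> \<gamma>)
    thus ?thesis using assms pos_sums_tot_pos by (auto simp: indecomposables_def)
  qed
qed

text \<open>If \<open>c t\<close> were a unit, \<open>t - y'\<close> would be invertible. Its
  inverse times its norm \<open>m\<close> is \<open>t - y\<close>, with coefficient -1 at
  \<open>y\<close>, so \<open>m\<close> divides 1; but
  \<open>m = 1 - a - (t - 1) (a - t)\<close>.\<close>

lemma c_not_unit:
  assumes "1 \<le> t" "t \<le> a" shows "c t \<notin> tot_pos_units K"
proof
  assume "c t \<in> tot_pos_units K"
  then obtain v where v: "v \<in> ring_of_integers K" "c t * v = 1"
    by (auto simp: tot_pos_units_def integer_units_def)
  have "comb (- 1) 0 0 1 * v \<in> ring_of_integers K" by (intro ring_of_integers_closed comb_in_ring v)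
  then obtain f0 f1 f2 f3 where f: "comb (- 1) 0 0 1 * v = comb f0 f1 f2 f3"
    by (rule ring_of_integers_comb)
  define m where "m = t * t - (a + 1) * t + 1"
  have m: "of_int m = (of_int t - y') * (of_int t - y)"
    using yy by (simp add: m_def algebra_simps)
  have "(of_int t - y') * (comb (- 1) 0 0 1 * v) = 1"
    using v(2) by (simp add: c_def comb_def algebra_simps)
  hence "of_int m * comb f0 f1 f2 f3 = of_int t - y"
    unfolding f[symmetric] m by (metis mult.assoc mult.commute mult_1)
  hence "comb (m * f0 - t) (m * f1) (m * f2 + 1) (m * f3) = 0"
    by (simp add: comb_def algebra_simps)
  from comb_eq_0[OF this] have "m * f2 = - 1" by simp
  hence "m dvd - 1" by (metis dvd_triv_left)
  hence "\<bar>m\<bar> = 1" by simp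
  moreover have "0 \<le> (t - 1) * (a - t)" using assms by simp
  hence "m \<le> 1 - a" by (simp add: m_def algebra_simps)
  ultimately show False using a_ge by simp
qed

text \<open>
  Units are indecomposable, so the unit group is a by-product of the classification.
\<close>

lemma tot_pos_units_eq: "tot_pos_units K = unit_group"
proof (intro equalityI subsetI)
  fix u assume u: "u \<in> tot_pos_units K"
  have "u * 1 \<in> indecomposables K" by (rule indecomposables_unit_mult[OF one_indecomposable u])
  then obtain g s where gs: "g \<in> unit_group" "s \<in> insert 1 (c ` {1..a})" "u = g * s"
    by (metis indecomposable_cases mult.right_neutral)
  have "s = inverse g * u" using gs(3) unit_group_pos[OF gs(1)] by (simp add: field_simps)
  hence "s \<in> tot_pos_units K"
    using tot_pos_units_mult[OF _ u] unit_group_inverse[OF gs(1)] unit_group_tot_pos_units by auto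
  hence "s = 1" using gs(2) c_not_unit by auto
  thus "u \<in> unit_group" using gs by simp
qed (use unit_group_tot_pos_units in blast)

lemma unit_group_K: "g \<in> unit_group \<Longrightarrow> g \<in> K"
  using unit_group_tot_pos_units
  by (auto simp: tot_pos_units_def tot_pos_integers_def ring_of_integers_def)

text \<open>
  The relative norm to \<open>\<rat>(sqrt q)\<close> kills \<open>x\<close> and \<open>e\<close>.
\<close>

lemma unit_group_conj:
  assumes \<sigma>: "real_embedding K \<sigma>" "\<sigma> x = x'" "\<sigma> y = y" and g: "g \<in> unit_group"
  obtains j :: int where "g * \<sigma> g = (y powi j)\<^sup>2"
proof -
  note \<sigma>' = real_embeddingD[OF \<sigma>(1) subfields(2)]
  have inv: "\<sigma> (inverse z) = inverse (\<sigma> z)" if "z \<in> K" "z \<noteq> 0" for z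
    using \<sigma>'(4)[OF that(1) is_subfieldD(6)[OF subfields(2) that(1)]] \<sigma>'(2) that(2)
    by (simp add: inverse_unique)
  have powi: "\<sigma> (z powi i) = \<sigma> z powi i" if "z \<in> K" "z \<noteq> 0" for z i
    using that real_embedding_power[OF \<sigma>(1) subfields(2)] is_subfieldD(6)[OF subfields(2)]
    by (simp add: power_int_def inv flip: power_inverse)
  obtain i j k where ijk: "g = x powi i * y powi j * e (x, y) powi k"
    using g by (auto simp: unit_group_def)
  have gens: "x powi i \<in> K" "y powi j \<in> K" "e (x, y) powi k \<in> K" "x \<in> K" "y \<in> K" "e (x, y) \<in> K" for i j k
    using unit_group_K unit_groupI[of i 0 0] unit_groupI[of 0 j 0] unit_groupI[of 0 0 k]
      unit_group_gens by simp_all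
  have "e (x, y) = elt (x, y) (me (a, - 1, 1, 0))"
    using elt_me[OF xy_place] elt_one[OF xy_place] by simp
  hence "\<sigma> (e (x, y)) = elt (x', y) (me (a, - 1, 1, 0))"
    using embedding_elt[OF \<sigma>(1)] \<sigma>(2,3) by simp
  also have "\<dots> = e (x', y)"
    using elt_me[of x' y] elt_one[of x' y] by (simp add: places_def)
  \<comment> \<open>Conjugating \<open>x\<close> inverts \<open>e\<close>, so the powers of
    \<open>x\<close> and of \<open>e\<close> cancel in \<open>g * \<sigma> g\<close>.\<close>
  also have "e (x', y) = e' (x, y)" by (simp add: e_def e'_def)
  finally have \<sigma>e: "\<sigma> (e (x, y)) = inverse (e (x, y))" by (simp only: e'_inverse)
  have "\<sigma> g = inverse x powi i * y powi j * inverse (e (x, y)) powi k"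
    unfolding ijk using gens xye_pos is_subfieldD(5)[OF subfields(2)]
    by (simp add: \<sigma>'(4) powi \<sigma> \<sigma>e x'_inverse)
  hence "g * \<sigma> g = (y powi j)\<^sup>2"
    unfolding ijk using xye_pos by (simp add: power_int_inverse power2_eq_square field_simps)
  thus ?thesis by (rule that)
qed

lemma c_inequivalent:
  assumes t: "1 \<le> t" "t < a" "1 \<le> t'" "t' < a" and g: "g \<in> unit_group" and eq: "c t' = g * c t"
  shows "t' = t"
proof -
  obtain \<sigma> where \<sigma>: "real_embedding K \<sigma>" "\<sigma> x = x'" "\<sigma> y = y"
    using place_embedding[of x' y] by (auto simp: places_def)
  obtain j where j: "g * \<sigma> g = (y powi j)\<^sup>2" by (rule unit_group_conj[OF \<sigma> g])
  have t_real: "1 \<le> (of_int t :: real)" "of_int t \<le> (of_int a - 1 :: real)"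
    "1 \<le> (of_int t' :: real)" "of_int t' \<le> (of_int a - 1 :: real)"
    using t by linarith+
  have tpos: "of_int t - y' > 0" "of_int t' - y' > 0" using t_real conj_bounds by linarith+
  have "c t \<in> K" using elt_in_ring by (simp add: c_elt ring_of_integers_def)
  hence "\<sigma> (c t') = \<sigma> g * \<sigma> (c t)"
    unfolding eq using real_embeddingD(4)[OF \<sigma>(1) subfields(2) unit_group_K[OF g]] by simp
  moreover have "\<sigma> (c k) = (x' * y - 1) * (of_int k - y')" for k
    unfolding c_elt embedding_elt[OF \<sigma>(1)] \<sigma>(2,3) by (simp add: elt_def)
  ultimately have "(x' * y - 1) * (of_int t' - y') = (x' * y - 1) * (\<sigma> g * (of_int t - y'))"
    by (simp only: mult.left_commute)
  hence 1: "of_int t' - y' = \<sigma> g * (of_int t - y')" using w_sign(2) by simp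
  have "(x * y - 1) * (of_int t' - y') = (x * y - 1) * (g * (of_int t - y'))"
    using eq by (simp add: c_def mult.left_commute)
  hence 2: "of_int t' - y' = g * (of_int t - y')" using w_sign(1) by simp
  have "(of_int t' - y') * (of_int t' - y') = (g * (of_int t - y')) * (\<sigma> g * (of_int t - y'))"
    by (rule arg_cong2[where f = "(*)", OF 2 1])
  also have "\<dots> = (g * \<sigma> g) * ((of_int t - y') * (of_int t - y'))" by (simp only: mult_ac)
  finally have "(of_int t' - y')\<^sup>2 = (y powi j * (of_int t - y'))\<^sup>2"
    unfolding j by (simp add: power2_eq_square mult_ac)
  hence tt: "of_int t' - y' = y powi j * (of_int t - y')"
    by (rule power2_eq_imp_eq) (use tpos xye_pos in auto)
  \<comment> \<open>A positive power of \<open>y\<close> makes the right side at least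
    \<open>y (1 - y') = y - 1\<close>, while \<open>R \<le> a - 1\<close> keeps the left side at
    most \<open>y - 2\<close>. For \<open>R = a\<close> equality \<open>a - y' = y (1 - y')\<close>
    holds, so the range must end at \<open>a - 1\<close>.\<close>
  have no: False if "of_int R - y' = y powi i * (of_int s - y')" "i \<ge> 1"
    "1 \<le> (of_int s :: real)" "of_int R \<le> (of_int a - 1 :: real)" for R s i :: int
  proof -
    have "y powi 1 \<le> y powi i" using that(2) x_gt y_gt by (intro power_int_increasing) auto
    hence "y * (1 - y') \<le> y powi i * (of_int s - y')"
      using that(3) conj_bounds xye_pos by (intro mult_mono) auto
    hence "y * (1 - y') \<le> of_int R - y'" by (simp only: that(1))
    moreover have "y * (1 - y') = y - 1" using right_diff_distrib[of y 1 y'] unfolding y'_eq by simp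
    ultimately have "y - 1 \<le> of_int R - y'" by (simp only:)
    thus False using that(4) by linarith
  qed
  consider "j \<ge> 1" | "j = 0" | "- j \<ge> 1" by linarith
  thus ?thesis
  proof cases
    case 1
    thus ?thesis using no[OF tt 1] t_real by blast
  next
    case 2
    thus ?thesis using tt by simp
  next
    case 3
    have "of_int t - y' = y powi (- j) * (of_int t' - y')"
      using tt xye_pos by (simp add: power_int_minus field_simps)
    thus ?thesis using no[OF _ 3] t_real by blast
  qed
qed

text \<open>
  The multiples of \<open>c k\<close> that occur in the theorem: \<open>k = 2 n\<close> gives the element \<open>(\<epsilon>\<^sub>p\<inverse> + \<epsilon>\<^sub>r) / 2\<close>, and
  \<open>k = 2 n + 1 + t\<close> the family starting with \<open>(\<epsilon>\<^sub>p + \<epsilon>\<^sub>r) / 2\<close>.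
\<close>

definition rep :: "int \<Rightarrow> real" where
  "rep k = (if k = 0 then 1 else if k < 2 * n then c k else if k = 2 * n then c k * x' else c k * y')"

lemma rep_unit_mult:
  obtains h where "h \<in> unit_group" "rep k = h * (if k = 0 then 1 else c k)"
proof -
  let ?h = "if k < 2 * n then 1 else if k = 2 * n then x' else y'"
  have "?h \<in> unit_group" using unit_group_gens by simp
  moreover have "rep k = ?h * (if k = 0 then 1 else c k)"
    using n_ge by (simp add: rep_def mult.commute)
  ultimately show ?thesis by (rule that)
qed

lemma rep_indecomposable:
  assumes "k \<in> {0..a - 1}" shows "rep k \<in> indecomposables K"
proof -
  obtain h where h: "h \<in> unit_group" "rep k = h * (if k = 0 then 1 else c k)" by (rule rep_unit_mult)
  have "(if k = 0 then 1 else c k) \<in> indecomposables K"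
    using assms one_indecomposable c_indecomposable by auto
  from indecomposables_unit_mult[OF this] show ?thesis using h by (simp add: tot_pos_units_eq)
qed

text \<open>Absorbing units leaves 1 and the \<open>c k\<close>: two of the latter are separated by
  \<open>c_inequivalent\<close>, and 1 from them because no \<open>c k\<close> is a unit.\<close>

lemma rep_inequivalent:
  assumes "k \<in> {0..a - 1}" "k' \<in> {0..a - 1}" "u \<in> tot_pos_units K" "rep k' = u * rep k"
  shows "k' = k"
proof -
  obtain h where h: "h \<in> unit_group" "rep k = h * (if k = 0 then 1 else c k)" by (rule rep_unit_mult)
  obtain h' where h': "h' \<in> unit_group" "rep k' = h' * (if k' = 0 then 1 else c k')" by (rule rep_unit_mult)
  define g where "g = inverse h' * (u * h)"
  have g: "g \<in> unit_group"
    unfolding g_def using assms(3) h(1) h'(1) by (simp add: tot_pos_units_eq unit_group_mult unit_group_inverse)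
  have eq: "(if k' = 0 then 1 else c k') = g * (if k = 0 then 1 else c k)"
    using assms(4) unit_group_pos[OF h'(1)] unfolding h h' g_def by (simp add: field_simps)
  consider "k = 0" "k' = 0" | "k = 0" "k' \<noteq> 0" | "k \<noteq> 0" "k' = 0" | "k \<noteq> 0" "k' \<noteq> 0" by blast
  thus ?thesis
  proof cases
    case 2
    hence "c k' \<in> tot_pos_units K" using eq g by (simp add: tot_pos_units_eq)
    thus ?thesis using c_not_unit[of k'] assms(2) 2 by auto
  next
    case 3
    hence "c k = inverse g" using eq inverse_unique[of g "c k"] by simp
    hence "c k \<in> tot_pos_units K" using unit_group_inverse[OF g] by (simp add: tot_pos_units_eq)
    thus ?thesis using c_not_unit[of k] assms(1) 3 by auto
  next
    case 4
    thus ?thesis using c_inequivalent[OF _ _ _ _ g] eq assms(1,2) by auto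
  qed simp
qed

lemma indecomposable_rep:
  assumes "\<alpha> \<in> indecomposables K"
  obtains k u where "k \<in> {0..a - 1}" "u \<in> tot_pos_units K" "\<alpha> = u * rep k"
proof -
  obtain g s where gs: "g \<in> unit_group" "s \<in> insert 1 (c ` {1..a})" "\<alpha> = g * s"
    by (rule indecomposable_cases[OF assms])
  have "\<exists>k\<in>{0..a - 1}. \<exists>h\<in>unit_group. s = h * (if k = 0 then 1 else c k)"
  proof (cases "s = c a \<and> s \<noteq> 1")
    case True
    have "of_int a - y' = y * (of_int 1 - y')" using yy by (simp add: algebra_simps)
    hence "c a = y * c 1" by (simp add: c_def)
    thus ?thesis using True a_ge unit_group_gens by (intro bexI[of _ 1] bexI[of _ y]) auto
  next
    case False
    then obtain k where "k \<in> {0..a - 1}" "s = (if k = 0 then 1 else c k)"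
    proof (cases "s = 1")
      case True
      thus thesis using that[of 0] a_ge by simp
    next
      case False
      then obtain t where t: "t \<in> {1..a}" "s = c t" using gs(2) by blast
      moreover have "t \<noteq> a" using \<open>\<not> (s = c a \<and> s \<noteq> 1)\<close> False t by auto
      ultimately show thesis using that[of t] by auto
    qed
    thus ?thesis using unit_group_gens(1) by (intro bexI[of _ k] bexI[of _ 1]) auto
  qed
  then obtain k h where k: "k \<in> {0..a - 1}" "h \<in> unit_group" "s = h * (if k = 0 then 1 else c k)"
    by blast
  obtain h' where h': "h' \<in> unit_group" "rep k = h' * (if k = 0 then 1 else c k)" by (rule rep_unit_mult)
  have "\<alpha> = (g * h * inverse h') * rep k"
    using unit_group_pos[OF h'(1)] by (simp add: gs(3) k(3) h'(2))
  moreover have "g * h * inverse h' \<in> tot_pos_units K"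
    using gs k h' by (simp add: tot_pos_units_eq unit_group_mult unit_group_inverse)
  ultimately show ?thesis using that k(1) by blast
qed

section \<open>Equivalence classes and their number\<close>

lemma indec_rel_equiv: "equiv (indecomposables K) (indec_rel K)"
proof (rule equivI)
  show "indec_rel K \<subseteq> indecomposables K \<times> indecomposables K" by (auto simp: indec_rel_def)
  show "refl_on (indecomposables K) (indec_rel K)"
    using one_tot_pos_unit by (auto simp: refl_on_def indec_rel_def intro!: bexI[of _ 1])
  show "sym (indec_rel K)"
  proof (rule symI)
    fix \<alpha> \<beta> assume "(\<alpha>, \<beta>) \<in> indec_rel K"
    then obtain u where u: "\<alpha> \<in> indecomposables K" "\<beta> \<in> indecomposables K" "u \<in> tot_pos_units K" "\<beta> = u * \<alpha>"
      by (auto simp: indec_rel_def)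
    moreover have "u \<noteq> 0" using u(3) by (auto simp: tot_pos_units_def integer_units_def)
    ultimately have "\<alpha> = inverse u * \<beta>" by simp
    thus "(\<beta>, \<alpha>) \<in> indec_rel K" using u tot_pos_units_inverse by (auto simp: indec_rel_def)
  qed
  show "trans (indec_rel K)"
  proof (rule transI)
    fix \<alpha> \<beta> \<gamma> assume "(\<alpha>, \<beta>) \<in> indec_rel K" "(\<beta>, \<gamma>) \<in> indec_rel K"
    then obtain u v where "\<alpha> \<in> indecomposables K" "\<gamma> \<in> indecomposables K"
      "u \<in> tot_pos_units K" "v \<in> tot_pos_units K" "\<gamma> = v * (u * \<alpha>)"
      by (auto simp: indec_rel_def)
    thus "(\<alpha>, \<gamma>) \<in> indec_rel K"
      using tot_pos_units_mult[of v u] by (auto simp: indec_rel_def mult.assoc intro!: bexI[of _ "v * u"])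
  qed
qed

lemma rep_rel:
  assumes "k \<in> {0..a - 1}" "\<alpha> \<in> indecomposables K"
  shows "(rep k, \<alpha>) \<in> indec_rel K \<longleftrightarrow> (\<exists>u\<in>tot_pos_units K. \<alpha> = u * rep k)"
  using assms rep_indecomposable by (auto simp: indec_rel_def)

lemma rep_rel_unique:
  assumes "k \<in> {0..a - 1}" "k' \<in> {0..a - 1}" "(rep k, rep k') \<in> indec_rel K"
  shows "k' = k"
  using assms rep_inequivalent by (auto simp: indec_rel_def)

theorem rep_complete: "complete_set_of_indecomposables K (rep ` {0..a - 1})"
  unfolding complete_set_of_indecomposables_def
proof (intro conjI ballI)
  show "rep ` {0..a - 1} \<subseteq> indecomposables K" using rep_indecomposable by blast
  fix \<alpha> assume \<alpha>: "\<alpha> \<in> indecomposables K"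
  obtain k u where k: "k \<in> {0..a - 1}" "u \<in> tot_pos_units K" "\<alpha> = u * rep k"
    by (rule indecomposable_rep[OF \<alpha>])
  show "\<exists>!s. s \<in> rep ` {0..a - 1} \<and> (s, \<alpha>) \<in> indec_rel K"
  proof (rule ex1I[of _ "rep k"])
    show k\<alpha>: "rep k \<in> rep ` {0..a - 1} \<and> (rep k, \<alpha>) \<in> indec_rel K"
      using k rep_rel[OF k(1) \<alpha>] by blast
    fix s assume "s \<in> rep ` {0..a - 1} \<and> (s, \<alpha>) \<in> indec_rel K"
    then obtain k' where k': "k' \<in> {0..a - 1}" "s = rep k'" "(rep k', \<alpha>) \<in> indec_rel K" by blast
    have "(rep k, rep k') \<in> indec_rel K"
      using indec_rel_equiv k\<alpha> k'(3) by (meson equivE symD transD)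
    thus "s = rep k" using rep_rel_unique[OF k(1) k'(1)] k'(2) by simp
  qed
qed

theorem iota_K: "int (\<iota> K) = a"
proof -
  have "bij_betw (\<lambda>k. indec_rel K `` {rep k}) {0..a - 1} (indecomposables K // indec_rel K)"
    unfolding bij_betw_def
  proof (intro conjI inj_onI equalityI subsetI)
    fix k k' assume "k \<in> {0..a - 1}" "k' \<in> {0..a - 1}" "indec_rel K `` {rep k} = indec_rel K `` {rep k'}"
    thus "k = k'"
      using eq_equiv_class[OF _ indec_rel_equiv] rep_indecomposable rep_rel_unique by metis
  next
    fix A assume "A \<in> (\<lambda>k. indec_rel K `` {rep k}) ` {0..a - 1}"
    thus "A \<in> indecomposables K // indec_rel K" using rep_indecomposable by (auto intro: quotientI)
  next
    fix A assume "A \<in> indecomposables K // indec_rel K"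
    then obtain \<alpha> where \<alpha>: "\<alpha> \<in> indecomposables K" "A = indec_rel K `` {\<alpha>}" by (rule quotientE)
    obtain k u where k: "k \<in> {0..a - 1}" "u \<in> tot_pos_units K" "\<alpha> = u * rep k"
      by (rule indecomposable_rep[OF \<alpha>(1)])
    have "(rep k, \<alpha>) \<in> indec_rel K" using k rep_rel[OF k(1) \<alpha>(1)] by blast
    hence "A = indec_rel K `` {rep k}" using equiv_class_eq[OF indec_rel_equiv] \<alpha>(2) by metis
    thus "A \<in> (\<lambda>k. indec_rel K `` {rep k}) ` {0..a - 1}" using k(1) by blast
  qed
  hence "\<iota> K = card {0..a - 1}" unfolding \<iota>_def by (metis bij_betw_same_card)
  thus ?thesis using a_ge by simp
qed

lemma rep_image:
  "rep ` {0..a - 1} = {1, (x' + e (x, y)) / 2}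
    \<union> {(x + e (x, y)) / 2 + of_int t * (x - y') | t::int. 0 \<le> t \<and> t \<le> 2 * n - 2}
    \<union> {(y' - x) + of_int t * (x * y - 1) | t::int. 1 \<le> t \<and> t \<le> 2 * n - 1}" (is "_ = _ \<union> ?B \<union> ?C")
proof -
  have img: "f ` {i..j} = {f t | t. i \<le> t \<and> t \<le> j}" for f :: "int \<Rightarrow> real" and i j by auto
  have an: "of_int a = (4 * of_int n :: real)" by (simp add: a_def)
  \<comment> \<open>Hence \<open>c t = t w - (x - y')\<close>, the last family, and
    \<open>c k * y' = (k - y') (x - y')\<close>, the family with step \<open>x - y'\<close>.\<close>
  have w: "(x * y - 1) * y' = x - y'" using y'_eq by (simp add: left_diff_distrib mult.assoc)
  have C: "(y' - x) + of_int t * (x * y - 1) = rep t" if "1 \<le> t" "t \<le> 2 * n - 1" for t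
    using that w by (simp add: rep_def c_def right_diff_distrib mult.commute)
  have A: "(x' + e (x, y)) / 2 = rep (2 * n)"
  proof -
    from conj_identity(1)[OF x'_eq y'_eq, of "of_int n"] have "x' + e (x, y) = 2 * (c (2 * n) * x')"
      using an by (simp add: c_def e_def)
    thus ?thesis using n_ge by (simp add: rep_def)
  qed
  have B: "(x + e (x, y)) / 2 + of_int t * (x - y') = rep (2 * n + 1 + t)" if "0 \<le> t" for t
  proof -
    have "c (2 * n + 1 + t) * y' = (of_int (2 * n + 1 + t) - y') * (x - y')"
      by (simp only: c_def mult_ac flip: w)
    also have "\<dots> = (2 * of_int n + 1 - y') * (x - y') + of_int t * (x - y')"
      by (simp only: of_int_add of_int_mult of_int_numeral of_int_1 flip: distrib_right) (simp add: algebra_simps)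
    also have "(2 * of_int n + 1 - y') * (x - y') = (x + e (x, y)) / 2"
    proof -
      have "2 * ((2 * of_int n + 1 - y') * (x - y')) = x + e (x, y)"
        using conj_identity(2)[OF x'_eq y'_eq, of "of_int n"] an by (simp add: e_def)
      thus ?thesis by simp
    qed
    finally have "c (2 * n + 1 + t) * y' = (x + e (x, y)) / 2 + of_int t * (x - y')" .
    thus ?thesis using n_ge that by (simp add: rep_def)
  qed
  have "{0..a - 1} = {0, 2 * n} \<union> (\<lambda>t. 2 * n + 1 + t) ` {0..2 * n - 2} \<union> {1..2 * n - 1}"
  proof (intro equalityI subsetI)
    fix k assume "k \<in> {0..a - 1}"
    moreover have "k = 2 * n + 1 + (k - 2 * n - 1)" by simp
    ultimately show "k \<in> {0, 2 * n} \<union> (\<lambda>t. 2 * n + 1 + t) ` {0..2 * n - 2} \<union> {1..2 * n - 1}"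
      by (cases "k \<le> 2 * n") (auto simp: a_def image_iff)
  qed (use n_ge in \<open>auto simp: a_def\<close>)
  hence "rep ` {0..a - 1} = {rep 0, rep (2 * n)} \<union> (\<lambda>t. rep (2 * n + 1 + t)) ` {0..2 * n - 2}
      \<union> rep ` {1..2 * n - 1}"
    by (simp only: image_Un image_insert image_empty image_image)
  moreover have "(\<lambda>t. rep (2 * n + 1 + t)) ` {0..2 * n - 2} = ?B"
  proof -
    have "(\<lambda>t. rep (2 * n + 1 + t)) ` {0..2 * n - 2}
        = (\<lambda>t. (x + e (x, y)) / 2 + of_int t * (x - y')) ` {0..2 * n - 2}"
      by (intro image_cong) (simp_all add: B)
    thus ?thesis by (rule trans[OF _ img])
  qed
  moreover have "rep ` {1..2 * n - 1} = ?C"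
  proof -
    have "rep ` {1..2 * n - 1} = (\<lambda>t. (y' - x) + of_int t * (x * y - 1)) ` {1..2 * n - 1}"
      by (intro image_cong) (simp_all add: C)
    thus ?thesis by (rule trans[OF _ img])
  qed
  moreover have "rep 0 = 1" by (simp add: rep_def)
  ultimately show ?thesis unfolding A by simp
qed

end

theorem theorem5p4:
  fixes n p q r :: int and K :: "real set" and \<epsilon>\<^sub>p \<epsilon>\<^sub>q \<epsilon>\<^sub>r :: real
  assumes "n \<ge> 2"
    and "p = (2 * n - 1) * (2 * n + 1)"
    and "q = (4 * n - 1) * (4 * n + 3)"
    and "coprime p q" and "squarefree p" and "squarefree q"
    and "r = p * q"
    and "K = rat_adjoin {sqrt (of_int p), sqrt (of_int q)}"
    and "is_fundamental_unit (rat_adjoin {sqrt (of_int p)}) \<epsilon>\<^sub>p"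
    and "is_fundamental_unit (rat_adjoin {sqrt (of_int q)}) \<epsilon>\<^sub>q"
    and "is_fundamental_unit (rat_adjoin {sqrt (of_int r)}) \<epsilon>\<^sub>r"
  shows "complete_set_of_indecomposables K
      ({1, (inverse \<epsilon>\<^sub>p + \<epsilon>\<^sub>r) / 2}
       \<union> {(\<epsilon>\<^sub>p + \<epsilon>\<^sub>r) / 2 + of_int t * (\<epsilon>\<^sub>p - inverse \<epsilon>\<^sub>q) | t::int. 0 \<le> t \<and> t \<le> 2 * n - 2}
       \<union> {(inverse \<epsilon>\<^sub>q - \<epsilon>\<^sub>p) + of_int t * (\<epsilon>\<^sub>p * \<epsilon>\<^sub>q - 1) | t::int. 1 \<le> t \<and> t \<le> 2 * n - 1})
    \<and> int (\<iota> K) = 4 * n"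
proof -
  let ?x = "2 * n + sqrt (of_int p)" and ?y = "(4 * n + 1 + sqrt (of_int q)) / 2"
  have p: "p = (2 * n) * (2 * n) - 1" and q: "q = (4 * n + 1) * (4 * n + 1) - 4"
    using assms(2,3) by (simp_all add: algebra_simps)
  have nn: "n * n \<ge> 2 * n" using assms(1) by simp
  have "p = 4 * (n * n) - 1" "q = 16 * (n * n) + 8 * n - 3" "(4 * n)\<^sup>2 = 16 * (n * n)"
    by (simp_all add: p q power2_eq_square algebra_simps)
  \<comment> \<open>The bound on \<open>q\<close> serves to separate the two units:
    \<open>x < 4 n < y\<close>.\<close>
  hence p0: "p \<ge> 0" and q16: "q \<ge> (4 * n)\<^sup>2" using nn assms(1) by linarith+
  have pp: "sqrt (of_int p) * sqrt (of_int p) = (2 * of_int n) * (2 * of_int n) - 1"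
    and qq: "sqrt (of_int q) * sqrt (of_int q) = of_int (4 * n + 1) * of_int (4 * n + 1) - 4"
  proof -
    have "sqrt (of_int p) * sqrt (of_int p) = of_int p" using p0 by simp
    thus "sqrt (of_int p) * sqrt (of_int p) = (2 * of_int n) * (2 * of_int n) - 1" by (simp add: p)
    have "q \<ge> 0" using q16 zero_le_power2[of "4 * n"] by linarith
    hence "sqrt (of_int q) * sqrt (of_int q) = of_int q" by simp
    thus "sqrt (of_int q) * sqrt (of_int q) = of_int (4 * n + 1) * of_int (4 * n + 1) - 4" by (simp add: q)
  qed
  have "of_int p < (2 * of_int n :: real)\<^sup>2" by (simp add: p power2_eq_square)
  hence sp: "sqrt (of_int p) < 2 * n" using assms(1) by (intro real_less_lsqrt) simp_all
  have "of_int ((4 * n)\<^sup>2) \<le> (of_int q :: real)" using q16 by (simp only: of_int_le_iff)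
  hence sq: "4 * n \<le> sqrt (of_int q)" by (intro real_le_rsqrt) simp
  have sp0: "sqrt (of_int p) \<ge> 0" using p0 by simp
  interpret biquadratic "4 * n" ?x ?y n p q
  proof
    show "3 \<le> 4 * n" using assms(1) by simp
    have "of_int n \<ge> (2::real)" using assms(1) by simp
    thus "1 < ?x" using sp0 by linarith
    show "?x < ?y" using sp sq by (simp add: field_simps)
    show "?x * ?x = of_int (4 * n) * ?x - 1"
      using pp by (simp add: algebra_simps)
    show "?y * ?y = of_int (4 * n + 1) * ?y - 1"
      using root_of_square_minus_4[OF qq, of ?y] by simp
  qed (use assms in simp_all)
  have K: "K = biquadratic.K p q"
    unfolding K_def assms(8) by (rule rat_adjoin_two) (use p0 q16 in simp_all)
  have r0: "r \<ge> 0" using pq_bounds assms(7) by simp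
  have \<epsilon>p: "\<epsilon>\<^sub>p = ?x"
    using fundamental_unit_3_mod_4[OF assms(5) p _ pq_mod(1)] assms(1,9) quad_field(2)[OF p0] by simp
  have \<epsilon>q: "\<epsilon>\<^sub>q = ?y"
    using fundamental_unit_1_mod_4[OF assms(6) q] assms(1,10) quad_field(2)[of q] pq_bounds by simp
  \<comment> \<open>With \<open>A = 2 n\<close> and \<open>B = 4 n + 1\<close>,
    \<open>(A^2 - 1) (B^2 - 4) = (A B - 2)^2 - (B - 2 A)^2\<close>, and
    \<open>B - 2 A = 1\<close>.\<close>
  have rT: "r = (8 * (n * n) + 2 * n - 2) * (8 * (n * n) + 2 * n - 2) - 1"
    unfolding assms(7) p q by (simp add: algebra_simps)
  have "8 * (n * n) + 2 * n - 2 \<ge> 2" using nn assms(1) by linarith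
  hence "\<epsilon>\<^sub>r = of_int (8 * (n * n) + 2 * n - 2) + sqrt (of_int r)"
    using fundamental_unit_3_mod_4[OF _ rT] sqf_pq pq_mod(3) assms(7,11) quad_field(2)[OF r0] by simp
  also have "sqrt (of_int r) = sqrt (of_int p) * sqrt (of_int q)"
    by (simp add: assms(7) real_sqrt_mult)
  \<comment> \<open>In \<open>x y + x' y'\<close> the terms with a single square root cancel,
    leaving \<open>2 n (4 n + 1) + sqrt p * sqrt q\<close>.\<close>
  also have "of_int (8 * (n * n) + 2 * n - 2) + sqrt (of_int p) * sqrt (of_int q) = e (?x, ?y)"
    unfolding e_def by (simp add: field_simps)
  finally have \<epsilon>r: "\<epsilon>\<^sub>r = e (?x, ?y)" .
  show ?thesis
    using rep_complete iota_K rep_image unfolding K \<epsilon>p \<epsilon>q \<epsilon>r x'_inverse y'_inverse by simp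
qed

end
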